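(* Let $I\subset S$ be a proper monomial ideal with no embedded prime ideals. If the polarization $I^p$ is $k$-clean (in the polynomial ring $S^p$), then $I$ is $k$-clean.
   Context: $S=K[x_1,\dots,x_n]$ is a polynomial ring over a field $K$. For a monomial $u=x_1^{a_1}\cdots x_n^{a_n}$, $\mathrm{supp}(u)=\{i: a_i>0\}$. The polarization of a monomial $u=x_{i_1}^{a_1}\cdots x_{i_t}^{a_t}$ (distinct $i_j$) is $u^p=\prod_{j=1}^t x_{i_j1}x_{i_j2}\cdots x_{i_ja_j}$, a squarefree monomial in a polynomial ring $S^p=K[x_{ij}:1\le i\le n,\,1\le j\le N]$ with $N$ large enough; the polarization of a monomial ideal $I$ with minimal monomial generating set $G(I)$ is $I^p=(u^p: u\in G(I))\subset S^p$. For an ideal $I$, $\min(I)$ denotes the set of minimal prime ideals of $I$. A monomial $u\neq 1$ with $u\notin I$ is a cleaner monomial of the monomial ideal $I$ if $\min(I+Su)\subseteq \min(I)$. For an integer $k\ge 0$, the class of $k$-clean monomial ideals (in any polynomial ring) is defined recursively (as the smallest class closed under the following rule): a proper monomial ideal $I$ is $k$-clean if either $I$ is a prime ideal, or $I$ has no embedded prime ideals (i.e. $\mathrm{Ass}(S/I)=\min(I)$) and there exists a cleaner monomial $u$ of $I$ with $|\mathrm{supp}(u)|\le k+1$ such that both $I:u$ and $I+Su$ are $k$-clean. *)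

theory Defs
  imports "HOL-Library.Poly_Mapping"
begin
(* Polynomials over a field k in variables v: type ((v =>0 nat) =>0 k); monomials are exponent vectors (v =>0 nat). *)

definition is_ideal :: "'a::comm_ring_1 set \<Rightarrow> bool" where
  "is_ideal I \<longleftrightarrow> 0 \<in> I \<and> (\<forall>a\<in>I. \<forall>b\<in>I. a + b \<in> I) \<and> (\<forall>a\<in>I. \<forall>r. r * a \<in> I)"

definition ideal_gen :: "'a::comm_ring_1 set \<Rightarrow> 'a set" where
  "ideal_gen A = \<Inter>{J. is_ideal J \<and> A \<subseteq> J}"

definition prime_ideal :: "'a::comm_ring_1 set \<Rightarrow> bool" where
  "prime_ideal P \<longleftrightarrow> is_ideal P \<and> P \<noteq> UNIV \<and> (\<forall>a b. a * b \<in> P \<longrightarrow> a \<in> P \<or> b \<in> P)"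

definition minprimes :: "'a::comm_ring_1 set \<Rightarrow> 'a set set" where
  "minprimes I = {P. prime_ideal P \<and> I \<subseteq> P \<and>
      (\<forall>Q. prime_ideal Q \<and> I \<subseteq> Q \<and> Q \<subseteq> P \<longrightarrow> Q = P)}"

definition colon :: "'a::comm_ring_1 set \<Rightarrow> 'a \<Rightarrow> 'a set" where
  "colon I f = {g. g * f \<in> I}"

definition Ass :: "'a::comm_ring_1 set \<Rightarrow> 'a set set" where
  "Ass I = {P. prime_ideal P \<and> (\<exists>f. P = colon I f)}"

definition mono :: "('v \<Rightarrow>\<^sub>0 nat) \<Rightarrow> (('v \<Rightarrow>\<^sub>0 nat) \<Rightarrow>\<^sub>0 'k::field)" where
  "mono m = Poly_Mapping.single m 1"

definition monomial_ideal :: "(('v \<Rightarrow>\<^sub>0 nat) \<Rightarrow>\<^sub>0 'k::field) set \<Rightarrow> bool" where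
  "monomial_ideal I \<longleftrightarrow> (\<exists>A. I = ideal_gen (mono ` A))"

definition mdvd :: "('v \<Rightarrow>\<^sub>0 nat) \<Rightarrow> ('v \<Rightarrow>\<^sub>0 nat) \<Rightarrow> bool" where
  "mdvd a b \<longleftrightarrow> (\<forall>x. Poly_Mapping.lookup a x \<le> Poly_Mapping.lookup b x)"

definition mingens :: "(('v \<Rightarrow>\<^sub>0 nat) \<Rightarrow>\<^sub>0 'k::field) set \<Rightarrow> ('v \<Rightarrow>\<^sub>0 nat) set" where
  "mingens I = {m. mono m \<in> I \<and> (\<forall>m'. (mono m' :: _ \<Rightarrow>\<^sub>0 'k) \<in> I \<and> mdvd m' m \<longrightarrow> m' = m)}"

definition polarize :: "(nat \<Rightarrow> 'w) \<Rightarrow> ('v \<Rightarrow>\<^sub>0 nat) \<Rightarrow> ('v \<times> 'w \<Rightarrow>\<^sub>0 nat)" where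
  "polarize idx m = (\<Sum>i\<in>Poly_Mapping.keys m. \<Sum>j\<in>{1..Poly_Mapping.lookup m i}. Poly_Mapping.single (i, idx j) 1)"

definition polarization :: "(nat \<Rightarrow> 'w) \<Rightarrow> (('v \<Rightarrow>\<^sub>0 nat) \<Rightarrow>\<^sub>0 'k::field) set
    \<Rightarrow> (('v \<times> 'w \<Rightarrow>\<^sub>0 nat) \<Rightarrow>\<^sub>0 'k) set" where
  "polarization idx I = ideal_gen {mono (polarize idx m) | m. m \<in> mingens I}"

definition cleaner :: "(('v \<Rightarrow>\<^sub>0 nat) \<Rightarrow>\<^sub>0 'k::field) set \<Rightarrow> ('v \<Rightarrow>\<^sub>0 nat) \<Rightarrow> bool" where
  "cleaner I u \<longleftrightarrow> u \<noteq> 0 \<and> mono u \<notin> I \<and>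
     minprimes (ideal_gen (insert (mono u) I)) \<subseteq> minprimes I"

inductive kclean :: "nat \<Rightarrow> (('v \<Rightarrow>\<^sub>0 nat) \<Rightarrow>\<^sub>0 'k::field) set \<Rightarrow> bool" for k where
  prime: "\<lbrakk>monomial_ideal I; I \<noteq> UNIV; prime_ideal I\<rbrakk> \<Longrightarrow> kclean k I"
| step: "\<lbrakk>monomial_ideal I; I \<noteq> UNIV; Ass I = minprimes I; cleaner I u;
          card (Poly_Mapping.keys u) \<le> k + 1; kclean k (colon I (mono u));
          kclean k (ideal_gen (insert (mono u) I))\<rbrakk> \<Longrightarrow> kclean k I"

end

theory Submission
  imports Defs
begin

text \<open>
  Encode a monomial ideal by the upward closed set of its exponent vectors. A k-clean ideal then
  carries a binary tree of colon and sum operations whose leaves are monomial primes, and for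
  \<open>I\<^sup>p\<close> these leaves are minimal primes of \<open>I\<^sup>p\<close>, each containing at most one variable \<open>x\<^sub>i\<^sub>j\<close>
  for every \<open>i\<close>. Identifying the variables \<open>x\<^sub>i\<^sub>j\<close> one at a time turns the tree into one for \<open>I\<close>:
  if no leaf contains both \<open>y\<close> and \<open>z\<close>, then \<open>y - z\<close> is a nonzerodivisor at every node, which
  combinatorially says that slices in the \<open>y, z\<close> directions have no inner corner, and this makes
  colons by the cleaner monomials commute with setting \<open>z = y\<close>. The images of the leaves are
  associated primes of \<open>I\<close>, hence minimal ones and pairwise incomparable, and for a tree with
  incomparable leaves all conditions in the definition of k-cleanness hold automatically.
\<close>

section \<open>Clean trees of upward closed sets of exponent vectors\<close>

text \<open>Exponents of the monomials in the prime ideal generated by the variables in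
  \<open>L\<close>.\<close>

definition leaf :: "'x set \<Rightarrow> ('x \<Rightarrow> nat) set" where
  "leaf L = {m. \<exists>x\<in>L. 0 < m x}"

text \<open>Exponents of the colon ideal by the monomial with exponent \<open>u\<close>.\<close>

definition shift_back :: "('x \<Rightarrow> nat) set \<Rightarrow> ('x \<Rightarrow> nat) \<Rightarrow> ('x \<Rightarrow> nat) set" where
  "shift_back U u = {m. (\<lambda>x. m x + u x) \<in> U}"

definition upset :: "('x \<Rightarrow> nat) set \<Rightarrow> bool" where
  "upset U \<longleftrightarrow> (\<forall>a\<in>U. \<forall>b. a \<le> b \<longrightarrow> b \<in> U)"

text \<open>\<open>\<Lambda>\<close> is fixed along the tree and lists the admissible leaf primes.
  Nothing about minimal or embedded primes is recorded, so that trees survive the identification of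
  variables; those conditions are recovered from the leaves afterwards.\<close>

inductive clean_tree :: "nat \<Rightarrow> 'x set set \<Rightarrow> ('x \<Rightarrow> nat) set \<Rightarrow> bool" for k \<Lambda> where
  leaf: "L \<in> \<Lambda> \<Longrightarrow> clean_tree k \<Lambda> (leaf L)"
| step: "card {x. u x \<noteq> 0} \<le> k + 1 \<Longrightarrow> clean_tree k \<Lambda> (shift_back U u)
    \<Longrightarrow> clean_tree k \<Lambda> (U \<union> {u..}) \<Longrightarrow> upset U \<Longrightarrow> clean_tree k \<Lambda> U"

lemma upsetD: "upset U \<Longrightarrow> a \<in> U \<Longrightarrow> (\<And>x. a x \<le> b x) \<Longrightarrow> b \<in> U"
  unfolding upset_def le_fun_def by blast

lemma upset_leaf: "upset (leaf L)"
  unfolding upset_def leaf_def le_fun_def by (fastforce intro: less_le_trans)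

lemma upset_shift_back: "upset U \<Longrightarrow> upset (shift_back U u)"
  unfolding upset_def shift_back_def le_fun_def by fastforce

lemma upset_Un_atLeast: "upset U \<Longrightarrow> upset (U \<union> {u..})"
  unfolding upset_def by auto

lemma clean_tree_upset: "clean_tree k \<Lambda> U \<Longrightarrow> upset U"
  by (induction rule: clean_tree.induct) (auto simp: upset_leaf)

text \<open>Every node is a proper ideal. For the two children of a node this says that
  \<open>u\<close> is nonzero and lies outside \<open>U\<close>, which is part of the cleaner
  condition.\<close>

lemma zero_notin_clean_tree: "clean_tree k \<Lambda> U \<Longrightarrow> (\<lambda>_. 0) \<notin> U"
  by (induction rule: clean_tree.induct) (auto simp: leaf_def)

text \<open>Multiplication by \<open>y - z\<close> is injective modulo \<open>U\<close>, in terms of monomials.\<close>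

lemma clean_tree_step_var:
  assumes "clean_tree k \<Lambda> U" "\<And>L. L \<in> \<Lambda> \<Longrightarrow> y \<notin> L \<or> z \<notin> L" "y \<noteq> z"
    and "g(y := Suc (g y)) \<in> U" "g(z := Suc (g z)) \<in> U"
  shows "g \<in> U"
  using assms
proof (induction arbitrary: g rule: clean_tree.induct)
  case (leaf L)
  then show ?case unfolding leaf_def by (auto split: if_splits)
next
  case (step u U)
  \<comment> \<open>The sum child gives membership in \<open>U \<union> {u..}\<close>. Only
    multiples of \<open>u\<close> remain, and dividing them by \<open>u\<close> moves the problem to
    the colon child.\<close>
  have "g \<in> U \<union> {u..}" using step by auto
  then show ?case
  proof
    assume "g \<in> {u..}"
    then have le: "u x \<le> g x" for x by (simp add: le_fun_def)
    define h where "h = (\<lambda>x. g x - u x)"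
    have "(\<lambda>x. (h(t := Suc (h t))) x + u x) = g(t := Suc (g t))" for t
      using le by (auto simp: h_def fun_eq_iff Suc_diff_le)
    then have "h \<in> shift_back U u" using step.IH(1)[of h] step.prems by (auto simp: shift_back_def)
    moreover have "(\<lambda>x. h x + u x) = g" using le by (auto simp: h_def)
    ultimately show ?thesis by (simp add: shift_back_def)
  qed
qed

text \<open>A slice in two coordinates has no inner corner, so it is closed under meets.\<close>

lemma clean_tree_slice_meet:
  assumes t: "clean_tree k \<Lambda> U" and L: "\<And>L. L \<in> \<Lambda> \<Longrightarrow> y \<notin> L \<or> z \<notin> L" and "y \<noteq> z"
    and "g(y := p, z := q) \<in> U" "g(y := p', z := q') \<in> U"
  shows "g(y := min p p', z := min q q') \<in> U"
proof -
  note up = upsetD[OF clean_tree_upset[OF t]]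
  \<comment> \<open>Induction on \<open>i + j\<close>. With both positive, the corners at
    \<open>(Suc p, q)\<close> and \<open>(p, Suc q)\<close> come from smaller rectangles, and the
    single-step lemma then closes the corner at \<open>(p, q)\<close>.\<close>
  have corner: "g(y := p, z := q) \<in> U"
    if "g(y := p + i, z := q) \<in> U" "g(y := p, z := q + j) \<in> U" for p q i j
    using that
  proof (induction "i + j" arbitrary: i j p q)
    case 0
    then show ?case by simp
  next
    case (Suc n)
    show ?case
    proof (cases "i = 0 \<or> j = 0")
      case True
      then show ?thesis using Suc by auto
    next
      case False
      then obtain i' j' where ij: "i = Suc i'" "j = Suc j'" by (meson not0_implies_Suc)
      have "g(y := Suc p, z := q + j) \<in> U" by (rule up[OF Suc.prems(2)]) auto
      then have 1: "g(y := Suc p, z := q) \<in> U"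
        using Suc.hyps(1)[of i' j "Suc p" q] Suc.hyps(2) Suc.prems(1) ij by simp
      have "g(y := p + i, z := Suc q) \<in> U" by (rule up[OF Suc.prems(1)]) auto
      then have 2: "g(y := p, z := Suc q) \<in> U"
        using Suc.hyps(1)[of i j' p "Suc q"] Suc.hyps(2) Suc.prems(2) ij by simp
      show ?thesis
        using clean_tree_step_var[OF t L \<open>y \<noteq> z\<close>, of "g(y := p, z := q)"] 1 2 \<open>y \<noteq> z\<close>
        by (simp add: fun_upd_twist)
    qed
  qed
  \<comment> \<open>If the two points are comparable, their meet is one of them; only the crossed
    orders use the corner.\<close>
  consider "p \<le> p'" "q \<le> q'" | "p' \<le> p" "q' \<le> q" | "p \<le> p'" "q' \<le> q" | "p' \<le> p" "q \<le> q'"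
    by linarith
  then show ?thesis
  proof cases
    case 3
    then show ?thesis using corner[of p "p' - p" q' "q - q'"] assms(4,5) by (simp add: min_def)
  next
    case 4
    then show ?thesis using corner[of p' "p - p'" q "q' - q"] assms(4,5) by (simp add: min_def)
  qed (use assms(4,5) in \<open>auto simp: min_def split: if_splits\<close>)
qed

section \<open>Identifying variables\<close>

text \<open>Exponent of the image of a monomial under the substitution sending each variable
  \<open>x\<close> to \<open>f x\<close>.\<close>

definition push :: "('x::finite \<Rightarrow> 'y) \<Rightarrow> ('x \<Rightarrow> nat) \<Rightarrow> 'y \<Rightarrow> nat" where
  "push f a y = (\<Sum>x\<in>UNIV. if f x = y then a x else 0)"

text \<open>The upward closure makes this the exponent set of the ideal generated by the images of
  the monomials in \<open>U\<close>.\<close>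

definition push_set :: "('x::finite \<Rightarrow> 'y) \<Rightarrow> ('x \<Rightarrow> nat) set \<Rightarrow> ('y \<Rightarrow> nat) set" where
  "push_set f U = {m. \<exists>a\<in>U. push f a \<le> m}"

lemma push_setI: "a \<in> U \<Longrightarrow> push f a \<le> m \<Longrightarrow> m \<in> push_set f U"
  unfolding push_set_def by blast

lemma push_add: "push f (\<lambda>x. a x + b x) = (\<lambda>y. push f a y + push f b y)"
  unfolding push_def by (auto simp: fun_eq_iff simp flip: sum.distrib intro!: sum.cong)

lemma push_mono: "a \<le> b \<Longrightarrow> push f a \<le> push f b"
  unfolding push_def le_fun_def by (auto intro!: sum_mono)

lemma le_push: "a x \<le> push f a (f x)"
  unfolding push_def by (rule order_trans[OF _ member_le_sum[of x]]) auto

lemma push_comp: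
  fixes f :: "'y::finite \<Rightarrow> 'z" and g :: "'x::finite \<Rightarrow> 'y"
  shows "push f (push g a) = push (f \<circ> g) a"
proof
  fix z
  have "push f (push g a) z = (\<Sum>y\<in>UNIV. \<Sum>x\<in>UNIV. if g x = y then if f y = z then a x else 0 else 0)"
    unfolding push_def by (auto intro!: sum.cong)
  also have "\<dots> = push (f \<circ> g) a z"
    unfolding push_def by (subst sum.swap) (auto intro!: sum.cong simp: sum.delta)
  finally show "push f (push g a) z = push (f \<circ> g) a z" .
qed

lemma push_set_comp:
  fixes f :: "'y::finite \<Rightarrow> 'z" and g :: "'x::finite \<Rightarrow> 'y"
  shows "push_set f (push_set g U) = push_set (f \<circ> g) U"
proof -
  have "m \<in> push_set f (push_set g U)" if "a \<in> U" "push (f \<circ> g) a \<le> m" for m a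
    using that unfolding push_set_def push_comp[symmetric] by blast
  moreover have "m \<in> push_set (f \<circ> g) U" if "a \<in> U" "push g a \<le> b" "push f b \<le> m" for m a b
    using that push_mono[OF that(2), of f] unfolding push_set_def push_comp by force
  ultimately show ?thesis by (auto simp: push_set_def)
qed

lemma push_id [simp]: "push id a = a"
  unfolding push_def by (auto simp: fun_eq_iff)

lemma push_set_id: "upset U \<Longrightarrow> push_set id U = U"
  by (auto simp: push_set_def upset_def)

lemma upset_push_set: "upset (push_set f U)"
  unfolding upset_def push_set_def by (blast intro: order_trans)

lemma push_set_leaf: "push_set f (leaf L) = leaf (f ` L)"
proof (intro equalityI subsetI)
  fix m assume "m \<in> push_set f (leaf L)"
  then obtain a x where "x \<in> L" "0 < a x" "push f a \<le> m" by (auto simp: push_set_def leaf_def)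
  then have "0 < m (f x)" using le_push[of a x f] by (meson le_funD less_le_trans)
  then show "m \<in> leaf (f ` L)" using \<open>x \<in> L\<close> by (auto simp: leaf_def)
next
  fix m assume "m \<in> leaf (f ` L)"
  then obtain x where x: "x \<in> L" "0 < m (f x)" by (auto simp: leaf_def)
  let ?a = "\<lambda>t. if t = x then 1 else 0 :: nat"
  have "push f ?a y = (\<Sum>t\<in>UNIV. if t = x then if f x = y then 1 else 0 else 0)" for y
    unfolding push_def by (intro sum.cong) auto
  then have "push f ?a y = (if f x = y then 1 else 0)" for y by simp
  then have "push f ?a \<le> m" using x by (auto simp: le_fun_def)
  moreover have "?a \<in> leaf L" using x by (auto simp: leaf_def)
  ultimately show "m \<in> push_set f (leaf L)" unfolding push_set_def by blast
qed

lemma push_set_Un_atLeast: "push_set f (U \<union> {u..}) = push_set f U \<union> {push f u..}"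
  using push_mono[of u _ f] by (fastforce simp: push_set_def intro: order_trans)

lemma card_support_push: "card {y. push f u y \<noteq> 0} \<le> card {x. u x \<noteq> 0}"
proof -
  have "{y. push f u y \<noteq> 0} \<subseteq> f ` {x. u x \<noteq> 0}"
    unfolding push_def by (auto simp: image_iff split: if_splits)
  then show ?thesis by (rule surj_card_le[rotated]) simp
qed

lemma push_merge:
  assumes "y \<noteq> z"
  shows "push (id(z := y)) a = a(y := a y + a z, z := 0)"
proof
  fix t
  have "push (id(z := y)) a t
      = (\<Sum>x\<in>UNIV. (if x = t then if t = z then 0 else a t else 0)
                  + (if x = z then if t = y then a z else 0 else 0))"
    unfolding push_def using assms by (intro sum.cong) auto
  then show "push (id(z := y)) a t = (a(y := a y + a z, z := 0)) t"
    using assms by (simp add: sum.distrib)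
qed

text \<open>Only the inclusion from right to left uses the tree: setting \<open>z = y\<close> could
  a priori enlarge the colon, because only the sum of the \<open>y\<close> and \<open>z\<close>
  exponents is controlled. Slice meets in \<open>U \<union> {u..}\<close> rule this out.\<close>

lemma push_set_shift_back_merge:
  fixes y z :: "'x::finite"
  assumes "y \<noteq> z" and t: "clean_tree k \<Lambda> (U \<union> {u..})" and up: "upset U"
    and L: "\<And>L. L \<in> \<Lambda> \<Longrightarrow> y \<notin> L \<or> z \<notin> L"
  shows "push_set (id(z := y)) (shift_back U u) = shift_back (push_set (id(z := y)) U) (push (id(z := y)) u)"
    (is "?l = ?r")
proof (intro equalityI subsetI)
  fix m assume "m \<in> ?l"
  then obtain a where "(\<lambda>x. a x + u x) \<in> U" "push (id(z := y)) a \<le> m"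
    by (auto simp: push_set_def shift_back_def)
  then show "m \<in> ?r"
    by (auto simp: push_set_def shift_back_def push_add le_fun_def intro!: bexI[of _ "\<lambda>x. a x + u x"])
next
  fix m assume "m \<in> ?r"
  then obtain a where "a \<in> U"
    and "(a(y := a y + a z, z := 0)) x \<le> m x + (u(y := u y + u z, z := 0)) x" for x
    by (auto simp: push_set_def shift_back_def push_merge[OF \<open>y \<noteq> z\<close>] le_fun_def)
  note le = this(2)
  have le_yz: "a y + a z \<le> m y + u y + u z" using le[of y] \<open>y \<noteq> z\<close> by simp
  \<comment> \<open>The vector \<open>m + u\<close> with its \<open>y\<close> and \<open>z\<close>
    entries overwritten by those of \<open>a\<close> still dominates \<open>a\<close>, so all
    further work takes place in one slice.\<close>
  define c where "c = (\<lambda>x. m x + u x)"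
  have cU: "c(y := a y, z := a z) \<in> U"
  proof (rule upsetD[OF up \<open>a \<in> U\<close>])
    show "a x \<le> (c(y := a y, z := a z)) x" for x using le[of x] by (auto simp: c_def)
  qed
  show "m \<in> ?l"
  proof (cases "u y \<le> a y \<and> u z \<le> a z")
    case True
    \<comment> \<open>Subtract \<open>u\<close> in both coordinates; the bound on
      \<open>a y + a z\<close> keeps the merged exponent at most \<open>m y\<close>.\<close>
    let ?b = "m(y := a y - u y, z := a z - u z)"
    have "(\<lambda>x. ?b x + u x) = c(y := a y, z := a z)" using True by (auto simp: c_def)
    moreover have "push (id(z := y)) ?b \<le> m"
      using le_yz True \<open>y \<noteq> z\<close> by (auto simp: push_merge le_fun_def)
    moreover have "?b \<in> shift_back U u" using cU calculation(1) unfolding shift_back_def by simp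
    ultimately show ?thesis by (intro push_setI)
  next
    case False
    \<comment> \<open>The meet with the slice point \<open>(u y, u z)\<close> is in
      \<open>U \<union> {u..}\<close> but not above \<open>u\<close>, hence in \<open>U\<close>. So
      the exponents of \<open>u\<close> alone suffice at \<open>y\<close> and \<open>z\<close>, and
      \<open>?b\<close> can vanish there.\<close>
    let ?b = "m(y := 0, z := 0)"
    have "u \<le> c(y := u y, z := u z)" by (auto simp: c_def le_fun_def)
    then have "c(y := min (a y) (u y), z := min (a z) (u z)) \<in> U \<union> {u..}"
      using cU by (intro clean_tree_slice_meet[OF t L \<open>y \<noteq> z\<close>]) auto
    moreover have "\<not> u \<le> c(y := min (a y) (u y), z := min (a z) (u z))"
    proof
      assume le: "u \<le> c(y := min (a y) (u y), z := min (a z) (u z))"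
      show False using le_funD[OF le, of y] le_funD[OF le, of z] \<open>y \<noteq> z\<close> False by simp
    qed
    ultimately have "c(y := min (a y) (u y), z := min (a z) (u z)) \<in> U" by simp
    then have "(\<lambda>x. ?b x + u x) \<in> U" by (rule upsetD[OF up]) (auto simp: c_def)
    moreover have "push (id(z := y)) ?b \<le> m" using \<open>y \<noteq> z\<close> by (auto simp: push_merge le_fun_def)
    moreover have "?b \<in> shift_back U u" using calculation(1) unfolding shift_back_def by simp
    ultimately show ?thesis by (intro push_setI)
  qed
qed

text \<open>Merging applies node by node: leaves and sums are mapped directly, colons by the
  commutation just shown, and the support of \<open>u\<close> does not grow.\<close>

lemma clean_tree_merge:
  fixes y z :: "'x::finite"
  assumes "clean_tree k \<Lambda> U" "y \<noteq> z" and L: "\<And>L. L \<in> \<Lambda> \<Longrightarrow> y \<notin> L \<or> z \<notin> L"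
  shows "clean_tree k ((`) (id(z := y)) ` \<Lambda>) (push_set (id(z := y)) U)"
  using assms(1)
proof (induction rule: clean_tree.induct)
  case (leaf L)
  then show ?case by (auto simp: push_set_leaf intro: clean_tree.leaf)
next
  case (step u U)
  show ?case
  proof (rule clean_tree.step)
    show "card {x. push (id(z := y)) u x \<noteq> 0} \<le> k + 1"
      using card_support_push step.hyps(1) by (rule order_trans)
    show "clean_tree k ((`) (id(z := y)) ` \<Lambda>)
        (shift_back (push_set (id(z := y)) U) (push (id(z := y)) u))"
      using step.IH(1) push_set_shift_back_merge[OF \<open>y \<noteq> z\<close> step.hyps(3,4) L] by metis
    show "clean_tree k ((`) (id(z := y)) ` \<Lambda>) (push_set (id(z := y)) U \<union> {push (id(z := y)) u..})"
      using step.IH(2) unfolding push_set_Un_atLeast .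
  qed (rule upset_push_set)
qed

text \<open>An idempotent map is a composition of single merges of \<open>z\<close> into
  \<open>h z\<close>. Injectivity on the leaves guarantees that no leaf ever contains both variables
  being merged.\<close>

lemma clean_tree_push_idem:
  fixes h :: "'x::finite \<Rightarrow> 'x"
  assumes t: "clean_tree k \<Lambda> U" and inj: "\<And>L. L \<in> \<Lambda> \<Longrightarrow> inj_on h L" and idem: "\<And>x. h (h x) = h x"
  shows "clean_tree k ((`) h ` \<Lambda>) (push_set h U)"
proof -
  \<comment> \<open>The partial substitution: only the variables in \<open>Z\<close> have been
    merged so far.\<close>
  define r where "r Z = (\<lambda>x. if x \<in> Z then h x else x)" for Z
  have "clean_tree k ((`) (r Z) ` \<Lambda>) (push_set (r Z) U)" if "finite Z" for Z
    using that
  proof (induction Z)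
    case empty
    have "r {} = id" by (auto simp: r_def)
    moreover have "(`) id ` \<Lambda> = \<Lambda>" by simp
    ultimately show ?case using t push_set_id[OF clean_tree_upset[OF t]] by metis
  next
    case (insert z Z)
    show ?case
    proof (cases "h z = z")
      case True
      then have "r (insert z Z) = r Z" by (auto simp: r_def fun_eq_iff)
      then show ?thesis using insert by simp
    next
      case False
      have hr: "h (r Z x) = h x" for x by (simp add: r_def idem)
      \<comment> \<open>Preimages of \<open>h z\<close> and of \<open>z\<close> in \<open>L\<close>
        have the same value under \<open>h\<close>, so they coincide, which contradicts
        \<open>h z \<noteq> z\<close>.\<close>
      have "h z \<notin> r Z ` L \<or> z \<notin> r Z ` L" if "L \<in> \<Lambda>" for L
      proof (rule ccontr)
        assume "\<not> ?thesis"
        then obtain x x' where x: "x \<in> L" "x' \<in> L" "h z = r Z x" "z = r Z x'" by auto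
        then have "h x = h x'" by (metis hr idem)
        then have "x = x'" using x inj[OF that] by (meson inj_onD)
        then show False using x False by simp
      qed
      then have "clean_tree k ((`) (id(z := h z)) ` (`) (r Z) ` \<Lambda>)
          (push_set (id(z := h z)) (push_set (r Z) U))"
        using False by (intro clean_tree_merge[OF insert.IH]) auto
      moreover have "id(z := h z) \<circ> r Z = r (insert z Z)"
        using insert.hyps by (auto simp: r_def fun_eq_iff idem)
      moreover have "(`) f ` (`) g ` \<Lambda> = (`) (f \<circ> g) ` \<Lambda>" for f g :: "'x \<Rightarrow> 'x"
        by (simp add: image_image image_comp)
      ultimately show ?thesis by (metis push_set_comp)
    qed
  qed
  from this[of UNIV] show ?thesis by (simp add: r_def)
qed

text \<open>Contraction to the polynomial subring on the variables in the range of \<open>g\<close>: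
  colons and sums by monomials of the subring restrict, and leaves lose the variables outside that
  range.\<close>

lemma clean_tree_pullback:
  fixes g :: "'y::finite \<Rightarrow> 'x::finite"
  assumes "clean_tree k \<Lambda> U" "inj g"
  shows "clean_tree k ((-`) g ` \<Lambda>) {m. push g m \<in> U}"
proof -
  have pg: "push g m (g y) = m y" for m y
    unfolding push_def using \<open>inj g\<close> by (simp add: inj_eq)
  have p0: "push g m x = 0" if "x \<notin> range g" for m x
    unfolding push_def using that by (auto intro!: sum.neutral)
  show ?thesis
    using assms(1)
  proof (induction rule: clean_tree.induct)
    case (leaf L)
    have "{m. push g m \<in> leaf L} = leaf (g -` L)"
    proof -
      have "(\<exists>x\<in>L. 0 < push g m x) \<longleftrightarrow> (\<exists>y\<in>g -` L. 0 < m y)" for m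
      proof
        assume "\<exists>x\<in>L. 0 < push g m x"
        then obtain x where x: "x \<in> L" "0 < push g m x" by blast
        then obtain y where "x = g y" using p0[of x m] by (cases "x \<in> range g") auto
        then show "\<exists>y\<in>g -` L. 0 < m y" using x by (auto simp: pg)
      next
        assume "\<exists>y\<in>g -` L. 0 < m y"
        then obtain y where "g y \<in> L" "0 < m y" by blast
        then show "\<exists>x\<in>L. 0 < push g m x" by (intro bexI[of _ "g y"]) (simp_all only: pg)
      qed
      then show ?thesis unfolding leaf_def by simp
    qed
    then show ?case using leaf by (auto intro: clean_tree.leaf)
  next
    case (step u U)
    have le_iff: "push g m \<le> push g m' \<longleftrightarrow> m \<le> m'" for m m'
    proof
      assume "push g m \<le> push g m'"
      then show "m \<le> m'" by (metis le_funI le_funD pg)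
    qed (rule push_mono)
    show ?case
    proof (cases "\<exists>x. x \<notin> range g \<and> u x \<noteq> 0")
      case True
      \<comment> \<open>Such a \<open>u\<close> divides no monomial of the subring, so the node and
        its sum child have the same restriction and the colon child is dropped.\<close>
      then have "\<not> u \<le> push g m" for m using p0 by (metis le_funD le_zero_eq)
      then show ?thesis using step.IH(2) by simp
    next
      case False
      \<comment> \<open>Now \<open>u\<close> is itself a monomial of the subring, with exponent
        \<open>v\<close> there.\<close>
      define v where "v = u \<circ> g"
      have u: "u = push g v"
      proof
        fix x show "u x = push g v x" using pg p0 False by (cases "x \<in> range g") (auto simp: v_def)
      qed
      have "g ` {y. v y \<noteq> 0} \<subseteq> {x. u x \<noteq> 0}" by (auto simp: v_def)
      then have "card {y. v y \<noteq> 0} \<le> card {x. u x \<noteq> 0}"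
        using \<open>inj g\<close> by (meson card_inj_on_le finite inj_on_subset subset_UNIV)
      show ?thesis
      proof (rule clean_tree.step)
        show "card {y. v y \<noteq> 0} \<le> k + 1" using \<open>card _ \<le> card _\<close> step.hyps(1) by simp
        show "clean_tree k ((-`) g ` \<Lambda>) (shift_back {m. push g m \<in> U} v)"
          using step.IH(1) by (simp add: shift_back_def u push_add)
        show "clean_tree k ((-`) g ` \<Lambda>) ({m. push g m \<in> U} \<union> {v..})"
          using step.IH(2) by (simp add: u le_iff Collect_disj_eq atLeast_def)
        show "upset {m. push g m \<in> U}"
          using step.hyps(4) push_mono unfolding upset_def by blast
      qed
    qed
  qed
qed

text \<open>A section \<open>g\<close> of \<open>f\<close> gives the idempotent
  \<open>g \<circ> f\<close> on the original variables, where merging applies; pulling back along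
  \<open>g\<close> then renames the representatives to their images.\<close>

lemma clean_tree_push:
  fixes f :: "'x::finite \<Rightarrow> 'y::finite"
  assumes t: "clean_tree k \<Lambda> U" and inj: "\<And>L. L \<in> \<Lambda> \<Longrightarrow> inj_on f L" and "surj f"
  shows "clean_tree k ((`) f ` \<Lambda>) (push_set f U)"
proof -
  define g where "g = inv f"
  have fg: "f (g y) = y" for y using \<open>surj f\<close> by (simp add: g_def surj_f_inv_f)
  then have "inj g" by (metis injI)
  define h where "h = g \<circ> f"
  have "clean_tree k ((`) h ` \<Lambda>) (push_set h U)"
  proof (rule clean_tree_push_idem[OF t])
    show "inj_on h L" if "L \<in> \<Lambda>" for L
      unfolding h_def using inj[OF that] \<open>inj g\<close> by (meson comp_inj_on inj_on_subset subset_UNIV)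
  qed (simp add: h_def fg)
  from clean_tree_pullback[OF this \<open>inj g\<close>]
  have "clean_tree k ((-`) g ` (`) h ` \<Lambda>) {m. push g m \<in> push_set h U}" .
  moreover have "g -` h ` L = f ` L" for L
    using \<open>inj g\<close> by (auto simp: h_def inj_eq)
  moreover have "{m. push g m \<in> push_set h U} = push_set f U"
  proof -
    have "push g m \<le> push g m' \<longleftrightarrow> m \<le> m'" for m m'
    proof
      assume "push g m \<le> push g m'"
      from push_mono[OF this, of f] show "m \<le> m'"
        by (simp add: push_comp comp_def fg flip: id_def)
    qed (rule push_mono)
    then show ?thesis by (simp add: push_set_def h_def flip: push_comp)
  qed
  ultimately show ?thesis by (simp add: image_image)
qed


section \<open>Associated and minimal primes along a colon/sum step\<close>

lemma is_ideal_ideal_gen: "is_ideal (ideal_gen A)"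
  unfolding is_ideal_def ideal_gen_def by blast

lemma ideal_gen_superset: "A \<subseteq> ideal_gen A"
  unfolding ideal_gen_def by blast

lemma ideal_gen_least: "is_ideal J \<Longrightarrow> A \<subseteq> J \<Longrightarrow> ideal_gen A \<subseteq> J"
  unfolding ideal_gen_def by blast

lemma is_ideal_sum: "is_ideal J \<Longrightarrow> (\<And>x. x \<in> A \<Longrightarrow> f x \<in> J) \<Longrightarrow> sum f A \<in> J"
  by (induction A rule: infinite_finite_induct) (auto simp: is_ideal_def)

lemma colon_superset: "is_ideal I \<Longrightarrow> I \<subseteq> colon I u"
  unfolding is_ideal_def colon_def by (auto simp: mult.commute)

lemma colon_colon: "colon (colon I u) f = colon I (f * u)"
  unfolding colon_def by (simp add: mult.assoc)

lemma is_ideal_diff: "is_ideal (I :: 'a::comm_ring_1 set) \<Longrightarrow> a \<in> I \<Longrightarrow> b \<in> I \<Longrightarrow> a - b \<in> I"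
proof -
  assume "is_ideal I" "a \<in> I" "b \<in> I"
  then have "a + (-1) * b \<in> I" unfolding is_ideal_def by blast
  then show "a - b \<in> I" by simp
qed

lemma ideal_gen_insert:
  assumes "is_ideal I"
  shows "ideal_gen (insert u I) = {i + r * u | i r. i \<in> I}"
proof (rule antisym)
  have "is_ideal {i + r * u | i r. i \<in> I}"
    unfolding is_ideal_def
  proof (intro conjI ballI allI)
    show "0 \<in> {i + r * u | i r. i \<in> I}"
      using assms unfolding is_ideal_def by (auto intro!: exI[of _ 0])
  next
    fix a b assume "a \<in> {i + r * u | i r. i \<in> I}" "b \<in> {i + r * u | i r. i \<in> I}"
    then obtain i r i' r' where *: "a = i + r * u" "b = i' + r' * u" "i \<in> I" "i' \<in> I" by blast
    then have "a + b = (i + i') + (r + r') * u" by (simp add: algebra_simps)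
    moreover have "i + i' \<in> I" using * assms unfolding is_ideal_def by blast
    ultimately show "a + b \<in> {i + r * u | i r. i \<in> I}" by blast
  next
    fix a s assume "a \<in> {i + r * u | i r. i \<in> I}"
    then obtain i r where *: "a = i + r * u" "i \<in> I" by blast
    then have "s * a = s * i + (s * r) * u" by (simp add: algebra_simps)
    moreover have "s * i \<in> I" using * assms unfolding is_ideal_def by blast
    ultimately show "s * a \<in> {i + r * u | i r. i \<in> I}" by blast
  qed
  moreover have "u \<in> {i + r * u | i r. i \<in> I}"
    using assms unfolding is_ideal_def by (intro CollectI exI[of _ 0] exI[of _ 1]) simp
  moreover have "I \<subseteq> {i + r * u | i r. i \<in> I}" by (force intro: exI[of _ 0])
  ultimately show "ideal_gen (insert u I) \<subseteq> {i + r * u | i r. i \<in> I}"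
    by (intro ideal_gen_least) auto
  show "{i + r * u | i r. i \<in> I} \<subseteq> ideal_gen (insert u I)"
    using is_ideal_ideal_gen[of "insert u I"] ideal_gen_superset[of "insert u I"]
    unfolding is_ideal_def by blast
qed

lemma Ass_prime:
  assumes "prime_ideal P"
  shows "Ass P = {P}"
proof -
  have "P = colon P 1" unfolding colon_def by simp
  then have "P \<in> Ass P" using assms unfolding Ass_def by blast
  moreover have "Q = P" if Q_Ass: "Q \<in> Ass P" for Q
  proof -
    obtain f where Q: "prime_ideal Q" "Q = colon P f" using Q_Ass unfolding Ass_def by blast
    have "f \<notin> P"
    proof
      assume "f \<in> P"
      then have "colon P f = UNIV"
        using assms unfolding colon_def prime_ideal_def is_ideal_def by blast
      then show False using Q unfolding prime_ideal_def by blast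
    qed
    then show "Q = P"
      using assms Q(2) colon_superset[of P f] unfolding colon_def prime_ideal_def by blast
  qed
  ultimately show ?thesis by blast
qed

lemma minprimes_prime: "prime_ideal P \<Longrightarrow> minprimes P = {P}"
  unfolding minprimes_def by blast

lemma Ass_colon_subset: "Ass (colon I u) \<subseteq> Ass I"
  unfolding Ass_def colon_colon by blast

text \<open>Associated primes in the exact sequence 0 -> S/(I:u) -> S/I -> S/(I+(u)) -> 0. If some
  \<open>r * f\<close> with \<open>r \<notin> P\<close> falls into the sum, then \<open>P\<close> is
  the annihilator of a multiple of \<open>u\<close> modulo \<open>I\<close>; otherwise
  \<open>f\<close> keeps the annihilator \<open>P\<close> modulo the sum.\<close>

lemma Ass_extension:
  assumes "is_ideal I"
  shows "Ass I \<subseteq> Ass (colon I u) \<union> Ass (ideal_gen (insert u I))"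
proof
  fix P assume "P \<in> Ass I"
  then obtain f where P: "prime_ideal P" "P = colon I f" unfolding Ass_def by blast
  show "P \<in> Ass (colon I u) \<union> Ass (ideal_gen (insert u I))"
  proof (cases "\<exists>r. r \<notin> P \<and> r * f \<in> ideal_gen (insert u I)")
    case True
    then obtain r i s where r: "r \<notin> P" "i \<in> I" "r * f = i + s * u"
      unfolding ideal_gen_insert[OF assms] by blast
    \<comment> \<open>Modulo \<open>I\<close> the elements \<open>r * f\<close> and
      \<open>s * u\<close> agree, and \<open>g * r\<close> lies in the prime \<open>P\<close>
      exactly when \<open>g\<close> does.\<close>
    have "P = colon I (s * u)"
    proof -
      have "g * (s * u) \<in> I \<longleftrightarrow> g * r \<in> P" for g
      proof -
        have "(g * r) * f = g * (s * u) + g * i"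
          unfolding mult.assoc r(3) by (simp add: algebra_simps)
        moreover from this have "g * (s * u) = (g * r) * f - g * i" by simp
        moreover have "g * i \<in> I" using assms r(2) unfolding is_ideal_def by blast
        ultimately show ?thesis
          using assms is_ideal_diff[OF assms, of "(g * r) * f" "g * i"]
          unfolding P(2) colon_def is_ideal_def by (metis mem_Collect_eq)
      qed
      moreover have "g * r \<in> P \<longleftrightarrow> g \<in> P" for g
        using P(1) r(1) unfolding prime_ideal_def is_ideal_def by (metis mult.commute)
      ultimately show ?thesis unfolding colon_def by blast
    qed
    then show ?thesis using P(1) unfolding Ass_def colon_colon by blast
  next
    case False
    then have "P = colon (ideal_gen (insert u I)) f"
      using P(2) ideal_gen_superset[of "insert u I"] unfolding colon_def by blast
    then show ?thesis using P(1) unfolding Ass_def by blast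
  qed
qed

lemma minprimes_mono:
  "P \<in> minprimes I \<Longrightarrow> I \<subseteq> J \<Longrightarrow> J \<subseteq> P \<Longrightarrow> P \<in> minprimes J"
  unfolding minprimes_def by blast

lemma prime_ideal_extension:
  assumes "prime_ideal P" "is_ideal I" "I \<subseteq> P"
  shows "colon I u \<subseteq> P \<or> ideal_gen (insert u I) \<subseteq> P"
proof (cases "u \<in> P")
  case True
  then show ?thesis using assms unfolding prime_ideal_def by (simp add: ideal_gen_least)
next
  case False
  then show ?thesis using assms unfolding prime_ideal_def colon_def by blast
qed

text \<open>That minimal primes are associated passes up from the children, without a Noetherian
  argument. If \<open>P\<close> does not contain the colon, it contains the sum; a witness
  \<open>f\<close> modulo the sum is then corrected by some \<open>v\<close> in the colon outside
  \<open>P\<close>, which sends multiples of \<open>u\<close> into \<open>I\<close>.\<close>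

lemma minprimes_subset_Ass_extension:
  assumes I: "is_ideal I"
    and "minprimes (colon I u) \<subseteq> Ass (colon I u)"
    and "minprimes (ideal_gen (insert u I)) \<subseteq> Ass (ideal_gen (insert u I))"
  shows "minprimes I \<subseteq> Ass I"
proof
  fix P assume P: "P \<in> minprimes I"
  then have Pp: "prime_ideal P" and Pi: "is_ideal P" and "I \<subseteq> P"
    unfolding minprimes_def prime_ideal_def by auto
  show "P \<in> Ass I"
  proof (cases "colon I u \<subseteq> P")
    case True
    then have "P \<in> minprimes (colon I u)" by (rule minprimes_mono[OF P colon_superset[OF I]])
    then show ?thesis using assms(2) Ass_colon_subset by blast
  next
    case False
    then have "ideal_gen (insert u I) \<subseteq> P" using prime_ideal_extension[OF Pp I \<open>I \<subseteq> P\<close>] by blast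
    then have "P \<in> minprimes (ideal_gen (insert u I))"
      using minprimes_mono[OF P, of "ideal_gen (insert u I)"] ideal_gen_superset[of "insert u I"] by simp
    then obtain f where f: "P = colon (ideal_gen (insert u I)) f"
      using assms(3) unfolding Ass_def by blast
    from False obtain v where v: "v * u \<in> I" "v \<notin> P" unfolding colon_def by blast
    have "P = colon I (f * v)"
    proof (intro equalityI subsetI)
      fix g assume "g \<in> P"
      then have "g * f \<in> ideal_gen (insert u I)" using f unfolding colon_def by simp
      then obtain i r where *: "i \<in> I" "g * f = i + r * u"
        unfolding ideal_gen_insert[OF I] by blast
      have "g * (f * v) = (g * f) * v" by (simp add: mult.assoc)
      also have "\<dots> = v * i + r * (v * u)" unfolding *(2) by (simp add: algebra_simps)
      finally have "g * (f * v) = v * i + r * (v * u)" .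
      then show "g \<in> colon I (f * v)"
        using * v(1) I unfolding colon_def is_ideal_def by auto
    next
      fix g assume "g \<in> colon I (f * v)"
      then have "(g * v) * f \<in> I" unfolding colon_def by (simp add: ac_simps)
      then have "g * v \<in> P"
        using ideal_gen_superset[of "insert u I"] unfolding f colon_def by blast
      then show "g \<in> P" using v(2) Pp unfolding prime_ideal_def by blast
    qed
    then show ?thesis using Pp unfolding Ass_def by blast
  qed
qed

section \<open>Monomial ideals as upward closed sets\<close>

lemma poly_mapping_eq_sum_single:
  "f = (\<Sum>m\<in>Poly_Mapping.keys f. Poly_Mapping.single m (Poly_Mapping.lookup f m))"
  by (rule poly_mapping_eqI)
    (simp add: lookup_sum lookup_single when_def in_keys_iff)

text \<open>Used to exhibit product coefficients that cannot cancel. The pair \<open>(a, b)\<close>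
  may lie outside the supports, in which case both sides vanish.\<close>

lemma lookup_mult_unique:
  fixes f g :: "'m::cancel_comm_monoid_add \<Rightarrow>\<^sub>0 'k::comm_semiring_1"
  assumes u: "\<And>a' b'. a' \<in> Poly_Mapping.keys f \<Longrightarrow> b' \<in> Poly_Mapping.keys g
      \<Longrightarrow> a' + b' = a + b \<Longrightarrow> a' = a \<and> b' = b"
  shows "Poly_Mapping.lookup (f * g) (a + b) = Poly_Mapping.lookup f a * Poly_Mapping.lookup g b"
proof -
  let ?F = "Poly_Mapping.lookup f" and ?G = "Poly_Mapping.lookup g"
  have "f * g = (\<Sum>a'\<in>Poly_Mapping.keys f. Poly_Mapping.single a' (?F a'))
      * (\<Sum>b'\<in>Poly_Mapping.keys g. Poly_Mapping.single b' (?G b'))"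
    by (intro arg_cong2[of _ _ _ _ "(*)"] poly_mapping_eq_sum_single)
  also have "\<dots> = (\<Sum>a'\<in>Poly_Mapping.keys f. \<Sum>b'\<in>Poly_Mapping.keys g.
      Poly_Mapping.single (a' + b') (?F a' * ?G b'))"
    by (simp only: sum_product mult_single)
  finally have "Poly_Mapping.lookup (f * g) (a + b) = (\<Sum>a'\<in>Poly_Mapping.keys f. \<Sum>b'\<in>Poly_Mapping.keys g.
      if a' + b' = a + b then ?F a' * ?G b' else 0)"
    by (simp add: lookup_sum lookup_single when_def)
  also have "\<dots> = (\<Sum>a'\<in>Poly_Mapping.keys f. \<Sum>b'\<in>Poly_Mapping.keys g.
      if b' = b then if a' = a then ?F a' * ?G b' else 0 else 0)"
    using u by (intro sum.cong) auto
  also have "\<dots> = (\<Sum>a'\<in>Poly_Mapping.keys f. if a' = a then ?F a' * ?G b else 0)"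
    by (intro sum.cong) (auto simp: in_keys_iff)
  also have "\<dots> = ?F a * ?G b"
    by (auto simp: in_keys_iff)
  finally show ?thesis .
qed

text \<open>Maximizing one coordinate after the other finds a product term that cannot cancel.\<close>

lemma unique_sum_on:
  fixes A B :: "('v \<Rightarrow>\<^sub>0 nat) set"
  assumes "finite S" "finite A" "finite B" "A \<noteq> {}" "B \<noteq> {}"
  shows "\<exists>a\<in>A. \<exists>b\<in>B. \<forall>a'\<in>A. \<forall>b'\<in>B. a' + b' = a + b \<longrightarrow>
    (\<forall>x\<in>S. Poly_Mapping.lookup a' x = Poly_Mapping.lookup a x
         \<and> Poly_Mapping.lookup b' x = Poly_Mapping.lookup b x)"
  using assms
proof (induction S arbitrary: A B)
  case empty
  then show ?case by auto
next
  case (insert x S)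
  define top where "top C = {c \<in> C. Poly_Mapping.lookup c x = Max ((\<lambda>c. Poly_Mapping.lookup c x) ` C)}"
    for C :: "('v \<Rightarrow>\<^sub>0 nat) set"
  have top: "finite (top C)" "top C \<noteq> {}" if "finite C" "C \<noteq> {}" for C
  proof -
    have "Max ((\<lambda>c. Poly_Mapping.lookup c x) ` C) \<in> (\<lambda>c. Poly_Mapping.lookup c x) ` C"
      using that by (intro Max_in) auto
    then obtain c where "c \<in> C" "Max ((\<lambda>c. Poly_Mapping.lookup c x) ` C) = Poly_Mapping.lookup c x"
      by (rule imageE)
    then have "c \<in> top C" by (simp add: top_def)
    then show "finite (top C)" "top C \<noteq> {}" using that unfolding top_def by auto
  qed
  have "\<exists>a\<in>top A. \<exists>b\<in>top B. \<forall>a'\<in>top A. \<forall>b'\<in>top B. a' + b' = a + b \<longrightarrow>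
    (\<forall>y\<in>S. Poly_Mapping.lookup a' y = Poly_Mapping.lookup a y
         \<and> Poly_Mapping.lookup b' y = Poly_Mapping.lookup b y)"
    by (rule insert.IH) (rule top insert.prems)+
  then obtain a b where ab: "a \<in> top A" "b \<in> top B" and u: "\<And>a' b' y. a' \<in> top A \<Longrightarrow> b' \<in> top B \<Longrightarrow> a' + b' = a + b
      \<Longrightarrow> y \<in> S \<Longrightarrow> Poly_Mapping.lookup a' y = Poly_Mapping.lookup a y
         \<and> Poly_Mapping.lookup b' y = Poly_Mapping.lookup b y"
    by blast
  have "\<forall>y\<in>insert x S. Poly_Mapping.lookup a' y = Poly_Mapping.lookup a y
         \<and> Poly_Mapping.lookup b' y = Poly_Mapping.lookup b y"
    if "a' \<in> A" "b' \<in> B" and eq: "a' + b' = a + b" for a' b'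
  proof -
    \<comment> \<open>Both exponents are bounded by the maxima and have the same sum as the maxima,
      so both are maximal.\<close>
    have le: "Poly_Mapping.lookup a' x \<le> Poly_Mapping.lookup a x"
      "Poly_Mapping.lookup b' x \<le> Poly_Mapping.lookup b x"
      using ab that(1,2) insert.prems by (auto simp: top_def)
    moreover have "Poly_Mapping.lookup a' x + Poly_Mapping.lookup b' x
        = Poly_Mapping.lookup a x + Poly_Mapping.lookup b x"
      using eq by (metis lookup_add)
    ultimately have x: "Poly_Mapping.lookup a' x = Poly_Mapping.lookup a x"
      "Poly_Mapping.lookup b' x = Poly_Mapping.lookup b x" by linarith+
    then have "a' \<in> top A" "b' \<in> top B" using ab that(1,2) by (auto simp: top_def)
    then show ?thesis using u eq x by auto
  qed
  moreover have "a \<in> A" "b \<in> B" using ab by (auto simp: top_def)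
  ultimately show ?case by blast
qed

text \<open>Membership is tested term by term; for upward closed \<open>U\<close> over finitely many
  variables these are exactly the monomial ideals. Plain functions serve as exponents, since over a
  finite variable type every function has finite support.\<close>

definition ideal_of :: "('v \<Rightarrow> nat) set \<Rightarrow> (('v \<Rightarrow>\<^sub>0 nat) \<Rightarrow>\<^sub>0 'k::field) set" where
  "ideal_of U = {f. \<forall>m\<in>Poly_Mapping.keys f. Poly_Mapping.lookup m \<in> U}"

lemma mono_in_ideal_of [simp]: "mono m \<in> ideal_of U \<longleftrightarrow> Poly_Mapping.lookup m \<in> U"
  by (simp add: ideal_of_def mono_def)

lemma is_ideal_ideal_of:
  assumes "upset U"
  shows "is_ideal (ideal_of U :: (('v \<Rightarrow>\<^sub>0 nat) \<Rightarrow>\<^sub>0 'k::field) set)"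
  unfolding is_ideal_def
proof (intro conjI ballI allI)
  fix a r :: "('v \<Rightarrow>\<^sub>0 nat) \<Rightarrow>\<^sub>0 'k" assume a: "a \<in> ideal_of U"
  show "r * a \<in> ideal_of U"
    unfolding ideal_of_def
  proof (intro CollectI ballI)
    fix m assume "m \<in> Poly_Mapping.keys (r * a)"
    then obtain p q where "m = p + q" "q \<in> Poly_Mapping.keys a" using keys_mult by blast
    then show "Poly_Mapping.lookup m \<in> U"
      using a upsetD[OF assms, of "Poly_Mapping.lookup q" "Poly_Mapping.lookup m"]
      by (auto simp: ideal_of_def lookup_add)
  qed
next
  fix a b :: "('v \<Rightarrow>\<^sub>0 nat) \<Rightarrow>\<^sub>0 'k" assume "a \<in> ideal_of U" "b \<in> ideal_of U"
  then show "a + b \<in> ideal_of U"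
    using keys_add[of a b] unfolding ideal_of_def by blast
qed (simp add: ideal_of_def)

lemma mono_mult: "mono a * mono b = mono (a + b)"
  by (simp add: mono_def mult_single)

lemma ideal_of_subset:
  fixes J :: "(('v \<Rightarrow>\<^sub>0 nat) \<Rightarrow>\<^sub>0 'k::field) set"
  assumes "is_ideal J" "\<And>m. Poly_Mapping.lookup m \<in> U \<Longrightarrow> mono m \<in> J"
  shows "ideal_of U \<subseteq> J"
proof
  fix f :: "('v \<Rightarrow>\<^sub>0 nat) \<Rightarrow>\<^sub>0 'k" assume f: "f \<in> ideal_of U"
  have "(\<Sum>m\<in>Poly_Mapping.keys f. Poly_Mapping.single m (Poly_Mapping.lookup f m)) \<in> J"
  proof (rule is_ideal_sum[OF assms(1)])
    fix m assume "m \<in> Poly_Mapping.keys f"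
    then have "mono m \<in> J" using f assms(2) unfolding ideal_of_def by blast
    moreover have "Poly_Mapping.single m (Poly_Mapping.lookup f m)
        = Poly_Mapping.single 0 (Poly_Mapping.lookup f m) * mono m"
      by (simp add: mono_def mult_single)
    ultimately show "Poly_Mapping.single m (Poly_Mapping.lookup f m) \<in> J"
      using assms(1) unfolding is_ideal_def by metis
  qed
  then show "f \<in> J" by (simp flip: poly_mapping_eq_sum_single)
qed

lemma mono_in_ideal:
  assumes "is_ideal J" "mono a \<in> J" "Poly_Mapping.lookup a \<le> Poly_Mapping.lookup m"
  shows "mono m \<in> J"
proof -
  have "m = (m - a) + a"
    using assms(3) by (intro poly_mapping_eqI) (simp add: lookup_add lookup_minus le_fun_def)
  then show ?thesis using assms(1,2) mono_mult unfolding is_ideal_def by metis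
qed

lemma upset_generated: "upset {m. \<exists>a\<in>A. a \<le> m}"
  unfolding upset_def by (blast intro: order_trans)

lemma ideal_gen_mono:
  "ideal_gen (mono ` A) = ideal_of {m. \<exists>a\<in>A. Poly_Mapping.lookup a \<le> m}"
proof (rule antisym)
  have "is_ideal (ideal_of {m. \<exists>a\<in>A. Poly_Mapping.lookup a \<le> m})"
    using upset_generated[of "Poly_Mapping.lookup ` A"] by (simp add: is_ideal_ideal_of)
  then show "ideal_gen (mono ` A) \<subseteq> ideal_of {m. \<exists>a\<in>A. Poly_Mapping.lookup a \<le> m}"
    by (rule ideal_gen_least) auto
  show "ideal_of {m. \<exists>a\<in>A. Poly_Mapping.lookup a \<le> m} \<subseteq> ideal_gen (mono ` A)"
    using ideal_gen_superset[of "mono ` A"] mono_in_ideal[OF is_ideal_ideal_gen[of "mono ` A"]]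
    by (intro ideal_of_subset is_ideal_ideal_gen) blast
qed

lemma monomial_ideal_E:
  assumes "monomial_ideal I"
  obtains U where "upset U" "I = ideal_of U"
proof -
  obtain A where "I = ideal_gen (mono ` A)" using assms unfolding monomial_ideal_def by blast
  then show thesis
    using that[of "{m. \<exists>a\<in>A. Poly_Mapping.lookup a \<le> m}"]
      upset_generated[of "Poly_Mapping.lookup ` A"] ideal_gen_mono[of A] by simp
qed

lemma lookup_Abs_finite [simp]: "Poly_Mapping.lookup (Abs_poly_mapping f) = f"
  for f :: "'v::finite \<Rightarrow> nat"
  by simp

lemma monomial_ideal_ideal_of:
  assumes "upset (U :: ('v::finite \<Rightarrow> nat) set)"
  shows "monomial_ideal (ideal_of U)"
proof -
  have "\<exists>a\<in>{a. Poly_Mapping.lookup a \<in> U}. Poly_Mapping.lookup a \<le> m" if "m \<in> U" for m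
    using that by (intro bexI[of _ "Abs_poly_mapping m"]) auto
  then have "{m. \<exists>a\<in>{a. Poly_Mapping.lookup a \<in> U}. Poly_Mapping.lookup a \<le> m} = U"
    using assms unfolding upset_def by blast
  then show ?thesis
    unfolding monomial_ideal_def
    by (intro exI[of _ "{a. Poly_Mapping.lookup a \<in> U}"]) (simp only: ideal_gen_mono)
qed

lemma ideal_of_subset_iff:
  fixes U V :: "('v::finite \<Rightarrow> nat) set"
  shows "(ideal_of U :: (('v \<Rightarrow>\<^sub>0 nat) \<Rightarrow>\<^sub>0 'k::field) set) \<subseteq> ideal_of V \<longleftrightarrow> U \<subseteq> V"
proof
  assume s: "(ideal_of U :: (('v \<Rightarrow>\<^sub>0 nat) \<Rightarrow>\<^sub>0 'k::field) set) \<subseteq> ideal_of V"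
  show "U \<subseteq> V"
  proof
    fix m assume "m \<in> U"
    then have "(mono (Abs_poly_mapping m) :: _ \<Rightarrow>\<^sub>0 'k) \<in> ideal_of U" by simp
    then have "(mono (Abs_poly_mapping m) :: _ \<Rightarrow>\<^sub>0 'k) \<in> ideal_of V" using s by blast
    then show "m \<in> V" by simp
  qed
qed (auto simp: ideal_of_def)

lemma ideal_of_inject:
  fixes U V :: "('v::finite \<Rightarrow> nat) set"
  shows "(ideal_of U :: (('v \<Rightarrow>\<^sub>0 nat) \<Rightarrow>\<^sub>0 'k::field) set) = ideal_of V \<longleftrightarrow> U = V"
  by (metis ideal_of_subset_iff order_antisym order_refl)

lemma leaf_subset_iff: "leaf L \<subseteq> leaf L' \<longleftrightarrow> L \<subseteq> L'"
proof
  assume s: "leaf L \<subseteq> leaf L'"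
  show "L \<subseteq> L'"
  proof
    fix x assume "x \<in> L"
    then have "(\<lambda>t. if t = x then 1 else 0) \<in> leaf L" unfolding leaf_def by auto
    then have "(\<lambda>t. if t = x then 1 else 0) \<in> leaf L'" using s by blast
    then show "x \<in> L'" unfolding leaf_def by (auto split: if_splits)
  qed
qed (auto simp: leaf_def)

text \<open>Multiplying by a monomial translates the support injectively, so no terms cancel and
  membership can be tested on each term separately.\<close>

lemma colon_ideal_of:
  "colon (ideal_of U) (mono u) = ideal_of (shift_back U (Poly_Mapping.lookup u))"
proof -
  have "Poly_Mapping.keys (f * mono u) = (\<lambda>m. m + u) ` Poly_Mapping.keys f"
    for f :: "('a \<Rightarrow>\<^sub>0 nat) \<Rightarrow>\<^sub>0 'b"
  proof -
    have "Poly_Mapping.lookup (f * mono u) (m + u) = Poly_Mapping.lookup f m" for m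
      by (subst lookup_mult_unique) (auto simp: mono_def)
    moreover have "Poly_Mapping.keys (f * mono u) \<subseteq> (\<lambda>m. m + u) ` Poly_Mapping.keys f"
      using keys_mult[of f "mono u"] by (auto simp: mono_def)
    ultimately show ?thesis by (auto simp: in_keys_iff)
  qed
  moreover have "Poly_Mapping.lookup (m + u) = (\<lambda>x. Poly_Mapping.lookup m x + Poly_Mapping.lookup u x)" for m
    by (simp add: lookup_add fun_eq_iff)
  ultimately show ?thesis
    by (simp add: colon_def ideal_of_def shift_back_def)
qed

lemma ideal_gen_insert_mono:
  assumes "upset U"
  shows "ideal_gen (insert (mono u) (ideal_of U :: (('v::finite \<Rightarrow>\<^sub>0 nat) \<Rightarrow>\<^sub>0 'k::field) set))
    = ideal_of (U \<union> {Poly_Mapping.lookup u..})"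
    (is "ideal_gen ?A = ?R")
proof (rule antisym)
  have "ideal_of U \<subseteq> ?R" by (simp add: ideal_of_subset_iff)
  then show "ideal_gen ?A \<subseteq> ?R"
    by (intro ideal_gen_least is_ideal_ideal_of upset_Un_atLeast assms) auto
  show "?R \<subseteq> ideal_gen ?A"
  proof (rule ideal_of_subset[OF is_ideal_ideal_gen])
    fix m assume "Poly_Mapping.lookup m \<in> U \<union> {Poly_Mapping.lookup u..}"
    then show "mono m \<in> ideal_gen ?A"
    proof
      assume "Poly_Mapping.lookup m \<in> U"
      then show ?thesis using ideal_gen_superset[of ?A] by auto
    next
      assume "Poly_Mapping.lookup m \<in> {Poly_Mapping.lookup u..}"
      then show ?thesis
        using ideal_gen_superset[of ?A]
        by (intro mono_in_ideal[OF is_ideal_ideal_gen, of u ?A m]) auto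
    qed
  qed
qed

lemma ideal_of_eq_UNIV_iff:
  assumes "upset U"
  shows "(ideal_of U :: (('v \<Rightarrow>\<^sub>0 nat) \<Rightarrow>\<^sub>0 'k::field) set) = UNIV \<longleftrightarrow> (\<lambda>_. 0) \<in> U"
proof
  assume "(ideal_of U :: (('v \<Rightarrow>\<^sub>0 nat) \<Rightarrow>\<^sub>0 'k::field) set) = UNIV"
  then have "(mono 0 :: _ \<Rightarrow>\<^sub>0 'k) \<in> ideal_of U" by simp
  then show "(\<lambda>_. 0) \<in> U" by (simp add: zero_poly_mapping.rep_eq)
next
  assume "(\<lambda>_. 0) \<in> U"
  then have "m \<in> U" for m by (rule upsetD[OF assms]) simp
  then show "(ideal_of U :: (('v \<Rightarrow>\<^sub>0 nat) \<Rightarrow>\<^sub>0 'k::field) set) = UNIV" by (simp add: ideal_of_def)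
qed

text \<open>A polynomial is outside the ideal when it has a term free of the variables in
  \<open>L\<close>. Among such terms of two factors there is a pair whose product cannot cancel, and
  this product is again free of \<open>L\<close>.\<close>

lemma prime_ideal_leaf:
  "prime_ideal (ideal_of (leaf L) :: (('v::finite \<Rightarrow>\<^sub>0 nat) \<Rightarrow>\<^sub>0 'k::field) set)"
proof -
  let ?P = "ideal_of (leaf L) :: (('v \<Rightarrow>\<^sub>0 nat) \<Rightarrow>\<^sub>0 'k) set"
  let ?off = "\<lambda>f :: ('v \<Rightarrow>\<^sub>0 nat) \<Rightarrow>\<^sub>0 'k. {m \<in> Poly_Mapping.keys f. Poly_Mapping.lookup m \<notin> leaf L}"
  have "f * g \<notin> ?P" if "f \<notin> ?P" "g \<notin> ?P" for f g
  proof -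
    have ne: "?off f \<noteq> {}" "?off g \<noteq> {}" using that by (auto simp: ideal_of_def)
    obtain a b where ab: "a \<in> ?off f" "b \<in> ?off g"
      and u: "\<And>a' b' x. a' \<in> ?off f \<Longrightarrow> b' \<in> ?off g \<Longrightarrow> a' + b' = a + b
        \<Longrightarrow> Poly_Mapping.lookup a' x = Poly_Mapping.lookup a x
         \<and> Poly_Mapping.lookup b' x = Poly_Mapping.lookup b x"
      using unique_sum_on[OF finite[of UNIV] _ _ ne] by auto
    \<comment> \<open>A product avoids \<open>L\<close> only if both factors do, so every pair
      competing for \<open>a + b\<close> consists of terms off the leaf, and uniqueness among those
      is enough.\<close>
    have off: "Poly_Mapping.lookup (p + q) \<notin> leaf L \<longleftrightarrow>
      Poly_Mapping.lookup p \<notin> leaf L \<and> Poly_Mapping.lookup q \<notin> leaf L" for p q :: "'v \<Rightarrow>\<^sub>0 nat"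
      by (auto simp: leaf_def lookup_add)
    have "Poly_Mapping.lookup (f * g) (a + b) = Poly_Mapping.lookup f a * Poly_Mapping.lookup g b"
    proof (rule lookup_mult_unique)
      fix a' b'
      assume *: "a' \<in> Poly_Mapping.keys f" "b' \<in> Poly_Mapping.keys g" "a' + b' = a + b"
      then have "Poly_Mapping.lookup (a' + b') \<notin> leaf L" using ab off[of a b] by simp
      then have "a' \<in> ?off f" "b' \<in> ?off g" using * off[of a' b'] by auto
      then show "a' = a \<and> b' = b" using u *(3) by (simp add: poly_mapping_eq_iff fun_eq_iff)
    qed
    then have "a + b \<in> Poly_Mapping.keys (f * g)" using ab by (simp add: in_keys_iff)
    moreover have "Poly_Mapping.lookup (a + b) \<notin> leaf L" using ab off by simp
    ultimately show ?thesis unfolding ideal_of_def by blast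
  qed
  moreover have "?P \<noteq> UNIV" unfolding ideal_of_eq_UNIV_iff[OF upset_leaf] by (simp add: leaf_def)
  ultimately show ?thesis
    unfolding prime_ideal_def using is_ideal_ideal_of[OF upset_leaf] by blast
qed


section \<open>Clean trees and k-clean ideals\<close>

text \<open>At every node a prime above the ideal contains one of the two children, so descending
  the tree ends in a leaf below that prime.\<close>

lemma clean_tree_leaf_below_prime:
  fixes U :: "('v::finite \<Rightarrow> nat) set" and Q :: "(('v \<Rightarrow>\<^sub>0 nat) \<Rightarrow>\<^sub>0 'k::field) set"
  assumes "clean_tree k \<Lambda> U" "prime_ideal Q" "ideal_of U \<subseteq> Q"
  shows "\<exists>L\<in>\<Lambda>. U \<subseteq> leaf L \<and> ideal_of (leaf L) \<subseteq> Q"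
  using assms
proof (induction rule: clean_tree.induct)
  case (leaf L)
  then show ?case by blast
next
  case (step u U)
  let ?u = "Abs_poly_mapping u"
  have I: "is_ideal (ideal_of U :: (('v \<Rightarrow>\<^sub>0 nat) \<Rightarrow>\<^sub>0 'k) set)"
    using step.hyps(4) by (rule is_ideal_ideal_of)
  have "U \<subseteq> shift_back U u"
    using step.hyps(4) unfolding shift_back_def upset_def le_fun_def by force
  moreover from prime_ideal_extension[OF step.prems(1) I step.prems(2), of "mono ?u"]
  have "ideal_of (shift_back U u) \<subseteq> Q \<or> ideal_of (U \<union> {u..}) \<subseteq> Q"
    by (simp add: colon_ideal_of ideal_gen_insert_mono[OF step.hyps(4)])
  ultimately show ?case using step.IH step.prems(1) by blast
qed

text \<open>Both inclusions pass from the two children to the node, and they hold at the leaves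
  because these are prime.\<close>

lemma clean_tree_Ass:
  fixes U :: "('v::finite \<Rightarrow> nat) set"
  assumes "clean_tree k \<Lambda> U"
  shows "Ass (ideal_of U :: (('v \<Rightarrow>\<^sub>0 nat) \<Rightarrow>\<^sub>0 'k::field) set) \<subseteq> (\<lambda>L. ideal_of (leaf L)) ` \<Lambda>
    \<and> minprimes (ideal_of U :: (('v \<Rightarrow>\<^sub>0 nat) \<Rightarrow>\<^sub>0 'k) set) \<subseteq> Ass (ideal_of U)"
  using assms
proof (induction rule: clean_tree.induct)
  case (leaf L)
  have "prime_ideal (ideal_of (leaf L) :: (('v \<Rightarrow>\<^sub>0 nat) \<Rightarrow>\<^sub>0 'k) set)" by (rule prime_ideal_leaf)
  then show ?case using leaf by (simp add: Ass_prime minprimes_prime)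
next
  case (step u U)
  let ?I = "ideal_of U :: (('v \<Rightarrow>\<^sub>0 nat) \<Rightarrow>\<^sub>0 'k) set" and ?u = "mono (Abs_poly_mapping u)"
  have I: "is_ideal ?I" using step.hyps(4) by (rule is_ideal_ideal_of)
  have *: "colon ?I ?u = ideal_of (shift_back U u)"
    "ideal_gen (insert ?u ?I) = ideal_of (U \<union> {u..})"
    by (simp_all add: colon_ideal_of ideal_gen_insert_mono[OF step.hyps(4)])
  show ?case
    using Ass_extension[OF I, of ?u] minprimes_subset_Ass_extension[OF I, of ?u] step.IH
    unfolding * by blast
qed

text \<open>Incomparability makes every leaf prime containing a node minimal over it. This yields
  the absence of embedded primes and the cleaner condition at all nodes at once.\<close>

lemma clean_tree_kclean:
  fixes U :: "('v::finite \<Rightarrow> nat) set"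
  assumes "clean_tree k \<Lambda> U" and anti: "\<And>L L'. L \<in> \<Lambda> \<Longrightarrow> L' \<in> \<Lambda> \<Longrightarrow> L \<subseteq> L' \<Longrightarrow> L = L'"
  shows "kclean k (ideal_of U :: (('v \<Rightarrow>\<^sub>0 nat) \<Rightarrow>\<^sub>0 'k::field) set)"
proof -
  let ?P = "\<lambda>L. ideal_of (leaf L) :: (('v \<Rightarrow>\<^sub>0 nat) \<Rightarrow>\<^sub>0 'k) set"
  \<comment> \<open>A prime \<open>Q\<close> between \<open>V\<close> and \<open>?P L\<close>
    contains some leaf prime \<open>?P L'\<close>, and \<open>L' \<subseteq> L\<close> forces
    equality throughout.\<close>
  have above: "?P L \<in> minprimes (ideal_of V)"
    if tree: "clean_tree k \<Lambda> V" and "L \<in> \<Lambda>" "ideal_of V \<subseteq> ?P L" for V L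
    unfolding minprimes_def
  proof (intro CollectI conjI allI impI)
    fix Q :: "(('v \<Rightarrow>\<^sub>0 nat) \<Rightarrow>\<^sub>0 'k) set"
    assume Q: "prime_ideal Q \<and> ideal_of V \<subseteq> Q \<and> Q \<subseteq> ?P L"
    then obtain L' where L': "L' \<in> \<Lambda>" "?P L' \<subseteq> Q"
      using clean_tree_leaf_below_prime[OF tree] by blast
    then have "L' \<subseteq> L" using Q by (metis ideal_of_subset_iff leaf_subset_iff order_trans)
    then show "Q = ?P L" using Q L' anti \<open>L \<in> \<Lambda>\<close> by blast
  qed (use that prime_ideal_leaf in auto)
  have minp: "minprimes (ideal_of V :: (('v \<Rightarrow>\<^sub>0 nat) \<Rightarrow>\<^sub>0 'k) set) \<subseteq> ?P ` \<Lambda>"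
    if "clean_tree k \<Lambda> V" for V
    using clean_tree_Ass[OF that] by (rule conjE) (rule order_trans)
  have proper: "(ideal_of V :: (('v \<Rightarrow>\<^sub>0 nat) \<Rightarrow>\<^sub>0 'k) set) \<noteq> UNIV" if "clean_tree k \<Lambda> V" for V
    using that by (simp add: ideal_of_eq_UNIV_iff clean_tree_upset zero_notin_clean_tree)
  show ?thesis
    using assms(1)
  proof (induction rule: clean_tree.induct)
    case (leaf L)
    then show ?case
      using proper[OF clean_tree.leaf[OF leaf]]
      by (intro kclean.prime monomial_ideal_ideal_of upset_leaf prime_ideal_leaf)
  next
    case (step u U)
    have U: "clean_tree k \<Lambda> U" using step.hyps by (rule clean_tree.step)
    let ?I = "ideal_of U :: (('v \<Rightarrow>\<^sub>0 nat) \<Rightarrow>\<^sub>0 'k) set" and ?u = "Abs_poly_mapping u"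
    have *: "colon ?I (mono ?u) = ideal_of (shift_back U u)"
      "ideal_gen (insert (mono ?u) ?I) = ideal_of (U \<union> {u..})"
      by (simp_all add: colon_ideal_of ideal_gen_insert_mono[OF step.hyps(4)])
    have sub: "?I \<subseteq> ideal_of (U \<union> {u..})" by (simp add: ideal_of_subset_iff)
    have "Ass ?I \<subseteq> minprimes ?I"
    proof
      fix P assume P: "P \<in> Ass ?I"
      then obtain L where L: "L \<in> \<Lambda>" "P = ?P L" using clean_tree_Ass[OF U] by blast
      have "?I \<subseteq> P"
        using P colon_superset[OF is_ideal_ideal_of[OF step.hyps(4)]] unfolding Ass_def by blast
      then show "P \<in> minprimes ?I" using above[OF U L(1)] L(2) by simp
    qed
    then have "Ass ?I = minprimes ?I" using clean_tree_Ass[OF U] by blast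
    moreover have "cleaner ?I ?u"
      unfolding cleaner_def *
    proof (intro conjI subsetI)
      show "?u \<noteq> 0"
      proof
        assume "?u = 0"
        then have "u = (\<lambda>_. 0)" by (metis lookup_Abs_finite zero_poly_mapping.rep_eq)
        then show False using zero_notin_clean_tree[OF step.hyps(3)] by simp
      qed
      show "mono ?u \<notin> ?I"
        using zero_notin_clean_tree[OF step.hyps(2)] by (simp add: shift_back_def)
    next
      fix P assume P: "P \<in> minprimes (ideal_of (U \<union> {u..}) :: (('v \<Rightarrow>\<^sub>0 nat) \<Rightarrow>\<^sub>0 'k) set)"
      then obtain L where L: "L \<in> \<Lambda>" "P = ?P L" using minp[OF step.hyps(3)] by blast
      have "?I \<subseteq> P" using P sub unfolding minprimes_def by blast
      then show "P \<in> minprimes ?I" using above[OF U L(1)] L(2) by simp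
    qed
    moreover have "card (Poly_Mapping.keys ?u) \<le> k + 1"
    proof -
      have "Poly_Mapping.keys ?u = {x. u x \<noteq> 0}" by (auto simp: in_keys_iff)
      then show ?thesis using step.hyps(1) by simp
    qed
    ultimately show ?case
      using proper[OF U] step.IH monomial_ideal_ideal_of[OF step.hyps(4)] kclean.step[of ?I ?u k]
      unfolding * by blast
  qed
qed

lemma kclean_Ass_eq_minprimes: "kclean k I \<Longrightarrow> Ass I = minprimes I"
  by (cases rule: kclean.cases) (simp_all add: Ass_prime minprimes_prime)

text \<open>Minimal primes do not grow along the recursion: for the sum by the cleaner condition,
  for the colon because its minimal primes are associated to \<open>I\<close>, which has no embedded
  primes. Hence all leaves can be drawn from \<open>\<Lambda>\<close>.\<close>

lemma kclean_clean_tree: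
  fixes I :: "(('v::finite \<Rightarrow>\<^sub>0 nat) \<Rightarrow>\<^sub>0 'k::field) set"
  assumes "kclean k I" "minprimes I \<subseteq> (\<lambda>L. ideal_of (leaf L)) ` \<Lambda>" "I = ideal_of U" "upset U"
  shows "clean_tree k \<Lambda> U"
  using assms
proof (induction arbitrary: U rule: kclean.induct)
  case (prime I)
  then obtain L where "L \<in> \<Lambda>" "I = ideal_of (leaf L)" by (auto simp: minprimes_prime)
  then show ?case using prime.prems by (auto simp: ideal_of_inject intro: clean_tree.leaf)
next
  case (step I u)
  have "minprimes (colon I (mono u)) \<subseteq> minprimes I"
    using kclean_Ass_eq_minprimes[OF step.hyps(6)] step.hyps(3) Ass_colon_subset by blast
  then have "clean_tree k \<Lambda> (shift_back U (Poly_Mapping.lookup u))"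
    using step.prems by (intro step.IH(1)) (auto simp: colon_ideal_of upset_shift_back)
  moreover have "clean_tree k \<Lambda> (U \<union> {Poly_Mapping.lookup u..})"
    using step.hyps(4) step.prems
    by (intro step.IH(2)) (auto simp: cleaner_def ideal_gen_insert_mono upset_Un_atLeast)
  moreover have "{x. Poly_Mapping.lookup u x \<noteq> 0} = Poly_Mapping.keys u"
    by (auto simp: in_keys_iff)
  ultimately show ?case
    using step.hyps(5) step.prems(3) by (metis clean_tree.step)
qed

section \<open>Minimal primes of a monomial ideal and minimal covers\<close>

lemma prime_ideal_mono_var:
  assumes "prime_ideal P" "mono m \<in> P"
  shows "\<exists>x. 0 < Poly_Mapping.lookup m x \<and> mono (Poly_Mapping.single x 1) \<in> P"
  using assms(2)
proof (induction "\<Sum>x\<in>Poly_Mapping.keys m. Poly_Mapping.lookup m x" arbitrary: m rule: less_induct)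
  case less
  show ?case
  proof (cases "m = 0")
    case True
    then have "1 \<in> P" using less.prems by (simp add: mono_def)
    then have "r * 1 \<in> P" for r using assms(1) unfolding prime_ideal_def is_ideal_def by blast
    then show ?thesis using assms(1) unfolding prime_ideal_def by auto
  next
    case False
    then obtain x where x: "x \<in> Poly_Mapping.keys m" by (metis in_keys_iff lookup_zero poly_mapping_eqI)
    \<comment> \<open>Splitting off one factor \<open>x\<close> lowers the total degree: either that
      variable lies in \<open>P\<close>, or the cofactor does and the induction hypothesis
      applies.\<close>
    define m' where "m' = m - Poly_Mapping.single x 1"
    have lm: "Poly_Mapping.lookup m' t = (if t = x then Poly_Mapping.lookup m t - 1 else Poly_Mapping.lookup m t)" for t
      by (simp add: m'_def lookup_minus lookup_single when_def)
    have "m = m' + Poly_Mapping.single x 1"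
      using x by (intro poly_mapping_eqI) (auto simp: m'_def lookup_add lookup_minus lookup_single when_def in_keys_iff)
    then have "mono m = mono m' * mono (Poly_Mapping.single x 1)" by (metis mono_mult)
    then consider "mono m' \<in> P" | "mono (Poly_Mapping.single x 1) \<in> P"
      using less.prems assms(1) unfolding prime_ideal_def by metis
    then show ?thesis
    proof cases
      case 1
      have "(\<Sum>t\<in>Poly_Mapping.keys m'. Poly_Mapping.lookup m' t) = (\<Sum>t\<in>Poly_Mapping.keys m. Poly_Mapping.lookup m' t)"
        by (rule sum.mono_neutral_left) (auto simp: in_keys_iff lm split: if_splits)
      also have "\<dots> < (\<Sum>t\<in>Poly_Mapping.keys m. Poly_Mapping.lookup m t)"
        using x by (intro sum_strict_mono_ex1 bexI[of _ x]) (auto simp: lm in_keys_iff)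
      finally obtain t where "0 < Poly_Mapping.lookup m' t" "mono (Poly_Mapping.single t 1) \<in> P"
        using less.hyps 1 by blast
      then show ?thesis by (intro exI[of _ t]) (simp add: lm split: if_splits)
    next
      case 2
      then show ?thesis using x by (auto simp: in_keys_iff)
    qed
  qed
qed

text \<open>For a monomial ideal these are the minimal vertex covers of the supports of its
  monomials.\<close>

definition min_covers :: "('v \<Rightarrow> nat) set \<Rightarrow> 'v set set" where
  "min_covers U = {L. U \<subseteq> leaf L \<and> (\<forall>L'. U \<subseteq> leaf L' \<and> L' \<subseteq> L \<longrightarrow> L' = L)}"

text \<open>A minimal prime contains the prime generated by its own variables, and that prime
  already contains the ideal; minimality makes them equal.\<close>

lemma minprimes_ideal_of:
  fixes U :: "('v::finite \<Rightarrow> nat) set"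
  shows "minprimes (ideal_of U :: (('v \<Rightarrow>\<^sub>0 nat) \<Rightarrow>\<^sub>0 'k::field) set)
    \<subseteq> (\<lambda>L. ideal_of (leaf L)) ` min_covers U"
proof
  fix P :: "(('v \<Rightarrow>\<^sub>0 nat) \<Rightarrow>\<^sub>0 'k) set" assume P: "P \<in> minprimes (ideal_of U)"
  then have Pp: "prime_ideal P" "is_ideal P" and UP: "ideal_of U \<subseteq> P"
    and min: "\<And>Q. prime_ideal Q \<Longrightarrow> ideal_of U \<subseteq> Q \<Longrightarrow> Q \<subseteq> P \<Longrightarrow> Q = P"
    unfolding minprimes_def prime_ideal_def by auto
  define L where "L = {x. (mono (Poly_Mapping.single x 1) :: _ \<Rightarrow>\<^sub>0 'k) \<in> P}"
  have "U \<subseteq> leaf L"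
  proof
    fix m assume "m \<in> U"
    then have "mono (Abs_poly_mapping m) \<in> P" using UP by (auto simp: subset_iff)
    from prime_ideal_mono_var[OF Pp(1) this] show "m \<in> leaf L" by (auto simp: leaf_def L_def)
  qed
  have "ideal_of (leaf L) \<subseteq> P"
  proof (rule ideal_of_subset[OF Pp(2)])
    fix m :: "'v \<Rightarrow>\<^sub>0 nat" assume "Poly_Mapping.lookup m \<in> leaf L"
    then obtain x where x: "x \<in> L" "0 < Poly_Mapping.lookup m x" by (auto simp: leaf_def)
    then have "Poly_Mapping.lookup (Poly_Mapping.single x 1) \<le> Poly_Mapping.lookup m"
      by (auto simp: le_fun_def lookup_single when_def)
    then show "mono m \<in> P" using x(1) mono_in_ideal[OF Pp(2)] by (auto simp: L_def)
  qed
  then have PL: "P = ideal_of (leaf L)"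
    using min[OF prime_ideal_leaf] \<open>U \<subseteq> leaf L\<close> by (metis ideal_of_subset_iff)
  have "L' = L" if "U \<subseteq> leaf L'" "L' \<subseteq> L" for L'
  proof -
    have "ideal_of (leaf L') = P"
      using that by (intro min prime_ideal_leaf) (simp_all add: PL ideal_of_subset_iff leaf_subset_iff)
    then have "leaf L' = leaf L" by (simp add: PL ideal_of_inject)
    then show ?thesis by (metis leaf_subset_iff order_antisym order_refl)
  qed
  then have "L \<in> min_covers U" using \<open>U \<subseteq> leaf L\<close> by (auto simp: min_covers_def)
  then show "P \<in> (\<lambda>L. ideal_of (leaf L)) ` min_covers U" using PL by blast
qed

text \<open>Removing \<open>x\<close> destroys the cover, so some monomial is covered by
  \<open>x\<close> alone.\<close>

lemma min_cover_private:
  assumes "L \<in> min_covers U" "x \<in> L"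
  obtains m where "m \<in> U" "0 < m x" "\<And>y. y \<in> L \<Longrightarrow> y \<noteq> x \<Longrightarrow> m y = 0"
proof -
  have "\<not> U \<subseteq> leaf (L - {x})" using assms by (auto simp: min_covers_def)
  then obtain m where m: "m \<in> U" "m \<notin> leaf (L - {x})" by blast
  have "m \<in> leaf L" using assms(1) m(1) by (auto simp: min_covers_def)
  then obtain y where "y \<in> L" "0 < m y" by (auto simp: leaf_def)
  moreover have "m y = 0" if "y \<in> L" "y \<noteq> x" for y using m(2) that by (auto simp: leaf_def)
  ultimately show thesis using m(1) by (metis less_irrefl that)
qed

section \<open>Polarization\<close>

text \<open>Injectivity of \<open>idx\<close> keeps the monomial squarefree in column
  \<open>i\<close>: distinct \<open>j\<close> contribute distinct variables, so none is counted
  twice.\<close>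

lemma lookup_polarize:
  assumes "inj_on idx {1..Poly_Mapping.lookup m i}"
  shows "Poly_Mapping.lookup (polarize idx m) (i, w) = (if w \<in> idx ` {1..Poly_Mapping.lookup m i} then 1 else 0)"
proof -
  let ?S = "{1..Poly_Mapping.lookup m i}"
  have "Poly_Mapping.lookup (polarize idx m) (i, w)
      = (\<Sum>i'\<in>Poly_Mapping.keys m. if i' = i then \<Sum>j\<in>?S. if idx j = w then 1 else (0::nat) else 0)"
    unfolding polarize_def lookup_sum
    by (intro sum.cong refl) (auto simp: lookup_single when_def simp del: One_nat_def)
  also have "\<dots> = (\<Sum>j\<in>?S. if idx j = w then 1 else (0::nat))"
    by (auto simp: in_keys_iff)
  also have "\<dots> = card {j \<in> ?S. idx j = w}" by (simp flip: sum.inter_filter)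
  also have "\<dots> = (if w \<in> idx ` ?S then 1 else 0)"
  proof (cases "w \<in> idx ` ?S")
    case True
    then obtain j where "j \<in> ?S" "idx j = w" by blast
    then have "{j \<in> ?S. idx j = w} = {j}" using assms by (auto dest: inj_onD)
    then show ?thesis using True by simp
  next
    case False
    then have "{j \<in> ?S. idx j = w} = {}" by blast
    then show ?thesis using False by (simp del: Collect_empty_eq)
  qed
  finally show ?thesis .
qed

text \<open>Depolarization: setting all variables of column \<open>i\<close> equal to the variable
  \<open>i\<close> counts the indices used, which is the original exponent.\<close>

lemma push_fst_polarize:
  fixes m :: "'v::finite \<Rightarrow>\<^sub>0 nat" and idx :: "nat \<Rightarrow> 'w::finite"
  assumes "\<And>i. inj_on idx {1..Poly_Mapping.lookup m i}"
  shows "push fst (Poly_Mapping.lookup (polarize idx m)) = Poly_Mapping.lookup m"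
proof
  fix i
  let ?S = "idx ` {1..Poly_Mapping.lookup m i}"
  have "push fst (Poly_Mapping.lookup (polarize idx m)) i
      = (\<Sum>(i', w)\<in>UNIV \<times> UNIV. if i' = i then if w \<in> ?S then 1 else 0 else 0)"
    unfolding push_def UNIV_Times_UNIV using assms
    by (intro sum.cong) (auto simp: lookup_polarize)
  also have "\<dots> = (\<Sum>i'\<in>UNIV. if i' = i then \<Sum>w\<in>UNIV. if w \<in> ?S then 1 else 0 else 0)"
    unfolding sum.cartesian_product[symmetric] by (intro sum.cong) auto
  also have "\<dots> = card ?S" by (simp flip: sum.inter_filter)
  also have "\<dots> = Poly_Mapping.lookup m i" using card_image[OF assms[of i]] by simp
  finally show "push fst (Poly_Mapping.lookup (polarize idx m)) i = Poly_Mapping.lookup m i" .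
qed

lemma ideal_of_mingens:
  fixes I :: "(('v::finite \<Rightarrow>\<^sub>0 nat) \<Rightarrow>\<^sub>0 'k::field) set"
  assumes "monomial_ideal I"
  shows "I = ideal_of {m. \<exists>g\<in>mingens I. Poly_Mapping.lookup g \<le> m}"
proof -
  obtain U where U: "upset U" "I = ideal_of U" using assms by (rule monomial_ideal_E)
  have "\<exists>g\<in>mingens I. Poly_Mapping.lookup g \<le> m" if "m \<in> U" for m
  proof -
    \<comment> \<open>A member of \<open>U\<close> below \<open>m\<close> of least total degree has
      no proper divisor in \<open>U\<close>, so it is a minimal generator.\<close>
    have "\<exists>a. a \<in> U \<and> a \<le> m" using that by blast
    then obtain a where a: "a \<in> U" "a \<le> m"
      and least: "\<And>b. b \<in> U \<Longrightarrow> b \<le> m \<Longrightarrow> (\<Sum>x\<in>UNIV. a x) \<le> (\<Sum>x\<in>UNIV. b x)"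
      using ex_has_least_nat[of "\<lambda>a. a \<in> U \<and> a \<le> m" _ "\<lambda>a. \<Sum>x\<in>UNIV. a x"] by blast
    have "b = Abs_poly_mapping a" if b: "Poly_Mapping.lookup b \<in> U" "mdvd b (Abs_poly_mapping a)" for b
    proof -
      have le: "Poly_Mapping.lookup b x \<le> a x" for x using b(2) by (simp add: mdvd_def)
      then have "(\<Sum>x\<in>UNIV. a x) \<le> (\<Sum>x\<in>UNIV. Poly_Mapping.lookup b x)"
        using a(2) by (intro least b(1) order_trans[OF _ a(2)]) (simp add: le_fun_def)
      then have "\<not> (\<exists>x. Poly_Mapping.lookup b x < a x)"
        using le sum_strict_mono_ex1[of UNIV "Poly_Mapping.lookup b" a] by auto
      then have "Poly_Mapping.lookup b = a" using le by (meson antisym_conv1 ext)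
      then show ?thesis by (metis lookup_inverse)
    qed
    then have "Abs_poly_mapping a \<in> mingens I" using a(1) by (auto simp: mingens_def U(2))
    then show ?thesis using a(2) by (intro bexI[of _ "Abs_poly_mapping a"]) simp_all
  qed
  moreover have "m \<in> U" if "g \<in> mingens I" "Poly_Mapping.lookup g \<le> m" for g m
    using that U unfolding mingens_def upset_def by auto
  ultimately have "{m. \<exists>g\<in>mingens I. Poly_Mapping.lookup g \<le> m} = U" by blast
  then show ?thesis using U(2) by simp
qed

lemma polarization_eq_ideal_of:
  fixes I :: "(('v \<Rightarrow>\<^sub>0 nat) \<Rightarrow>\<^sub>0 'k::field) set"
  shows "polarization idx I
    = ideal_of {a. \<exists>g\<in>mingens I. Poly_Mapping.lookup (polarize idx g) \<le> a}"
proof -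
  have "{mono (polarize idx m) :: _ \<Rightarrow>\<^sub>0 'k | m. m \<in> mingens I} = mono ` polarize idx ` mingens I" by blast
  then show ?thesis unfolding polarization_def by (simp add: ideal_gen_mono)
qed

text \<open>The monomial \<open>w0\<close> in the proof has exponent one below the polarization index of \<open>L\<close> on
  \<open>fst ` L\<close> and is saturated elsewhere; a maximal monomial above it outside \<open>I\<close> has
  annihilator \<open>ideal_of (leaf (fst ` L))\<close>.\<close>

lemma min_cover_polarization:
  fixes I :: "(('v::finite \<Rightarrow>\<^sub>0 nat) \<Rightarrow>\<^sub>0 'k::field) set" and idx :: "nat \<Rightarrow> 'w::finite"
  assumes mon: "monomial_ideal I" and idx: "inj_on idx {1..N}"
    and N: "\<And>g i. g \<in> mingens I \<Longrightarrow> Poly_Mapping.lookup g i \<le> N"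
    and L: "L \<in> min_covers {a. \<exists>g\<in>mingens I. Poly_Mapping.lookup (polarize idx g) \<le> a}"
  shows "inj_on fst L \<and> ideal_of (leaf (fst ` L)) \<in> Ass I"
proof -
  let ?G = "mingens I" and ?l = Poly_Mapping.lookup
  have pol: "?l (polarize idx g) (i, w) = (if w \<in> idx ` {1..?l g i} then 1 else 0)"
    if g: "g \<in> ?G" for g i w
    by (rule lookup_polarize, rule inj_on_subset[OF idx]) (use N[OF g, of i] in auto)
  have cover: "\<exists>(i, w)\<in>L. w \<in> idx ` {1..?l g i}" if g: "g \<in> ?G" for g
  proof -
    have "?l (polarize idx g) \<in> leaf L" using L g unfolding min_covers_def by blast
    then show ?thesis by (force simp: leaf_def pol[OF g] split: if_splits)
  qed
  \<comment> \<open>Each variable of the minimal cover has a private generator, whose polarization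
    meets \<open>L\<close> in that variable only.\<close>
  have priv: "\<exists>g\<in>?G. w \<in> idx ` {1..?l g i} \<and> (\<forall>(i', w')\<in>L. w' \<in> idx ` {1..?l g i'} \<longrightarrow> (i', w') = (i, w))"
    if iw: "(i, w) \<in> L" for i w
  proof -
    obtain a where "a \<in> {a. \<exists>g\<in>?G. ?l (polarize idx g) \<le> a}"
      and a0: "\<And>y. y \<in> L \<Longrightarrow> y \<noteq> (i, w) \<Longrightarrow> a y = 0"
      by (rule min_cover_private[OF L iw]) (rule that)
    then obtain g where a: "g \<in> ?G" "?l (polarize idx g) \<le> a" by blast
    have "(i', w') = (i, w)" if "(i', w') \<in> L" "w' \<in> idx ` {1..?l g i'}" for i' w'
    proof (rule ccontr)
      assume "(i', w') \<noteq> (i, w)"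
      then have "?l (polarize idx g) (i', w') = 0"
        using a0[OF that(1)] le_funD[OF a(2), of "(i', w')"] by simp
      then show False using that(2) pol[OF a(1), of i' w'] by simp
    qed
    then show ?thesis using a(1) cover[OF a(1)] by fast
  qed
  have inj: "inj_on fst L"
  proof -
    have eq: "w = w'" if ww: "(i, w) \<in> L" "(i, w') \<in> L" for i w w'
    proof -
      obtain g where g: "g \<in> ?G" "w \<in> idx ` {1..?l g i}"
        and gu: "\<And>i' w'. (i', w') \<in> L \<Longrightarrow> w' \<in> idx ` {1..?l g i'} \<Longrightarrow> (i', w') = (i, w)"
        using priv[OF ww(1)] by blast
      obtain g' where g': "g' \<in> ?G" "w' \<in> idx ` {1..?l g' i}"
        and gu': "\<And>i' w''. (i', w'') \<in> L \<Longrightarrow> w'' \<in> idx ` {1..?l g' i'} \<Longrightarrow> (i', w'') = (i, w')"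
        using priv[OF ww(2)] by blast
      \<comment> \<open>Within column \<open>i\<close> polarizations are initial segments, hence
        nested: of the two private generators, the one with the larger exponent contains both
        variables, against privacy.\<close>
      have "w \<in> idx ` {1..?l g' i} \<or> w' \<in> idx ` {1..?l g i}"
      proof (cases "?l g i \<le> ?l g' i")
        case True
        then have "{1..?l g i} \<subseteq> {1..?l g' i}" by auto
        then show ?thesis using g(2) by blast
      next
        case False
        then have "{1..?l g' i} \<subseteq> {1..?l g i}" by auto
        then show ?thesis using g'(2) by blast
      qed
      then show ?thesis using gu[OF ww(2)] gu'[OF ww(1)] by blast
    qed
    show ?thesis by (rule inj_onI) (use eq in \<open>force simp: prod_eq_iff\<close>)
  qed
  define F where "F = fst ` L"
  \<comment> \<open>\<open>Q\<close> ties the index \<open>d\<close> of the cover variable in column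
    \<open>i\<close> to a private generator \<open>g\<close>, so that both can be chosen
    together.\<close>
  define Q where "Q i d g \<longleftrightarrow> (i, idx d) \<in> L \<and> 1 \<le> d \<and> d \<le> N \<and> g \<in> ?G \<and>
      (\<forall>(i', w')\<in>L. w' \<in> idx ` {1..?l g i'} \<longrightarrow> (i', w') = (i, idx d))" for i d g
  have "\<exists>d g. Q i d g" if iF: "i \<in> F" for i
  proof -
    obtain w where iw: "(i, w) \<in> L" using iF by (auto simp: F_def)
    obtain g where g: "g \<in> ?G" "w \<in> idx ` {1..?l g i}"
        "\<forall>(i', w')\<in>L. w' \<in> idx ` {1..?l g i'} \<longrightarrow> (i', w') = (i, w)"
      using priv[OF iw] by blast
    then obtain d where "w = idx d" "1 \<le> d" "d \<le> ?l g i" by auto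
    then show ?thesis using g iw N[OF g(1), of i] by (intro exI[of _ d] exI[of _ g]) (auto simp: Q_def)
  qed
  then obtain d p where Q: "\<And>i. i \<in> F \<Longrightarrow> Q i (d i) (p i)" by metis
  then have dL: "\<And>i. i \<in> F \<Longrightarrow> (i, idx (d i)) \<in> L"
    and d: "\<And>i. i \<in> F \<Longrightarrow> 1 \<le> d i" "\<And>i. i \<in> F \<Longrightarrow> d i \<le> N"
    and p: "\<And>i. i \<in> F \<Longrightarrow> p i \<in> ?G"
    and pu: "\<And>i i' w'. i \<in> F \<Longrightarrow> (i', w') \<in> L \<Longrightarrow> w' \<in> idx ` {1..?l (p i) i'} \<Longrightarrow> (i', w') = (i, idx (d i))"
    unfolding Q_def by blast+
  define U where "U = {m. \<exists>g\<in>?G. ?l g \<le> m}"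
  have IU: "I = ideal_of U" unfolding U_def by (rule ideal_of_mingens[OF mon])
  have up: "upset U" unfolding U_def upset_def by (blast intro: order_trans)
  define w0 where "w0 = (\<lambda>i. if i \<in> F then d i - 1 else N)"
  \<comment> \<open>Each generator meets \<open>L\<close> in some \<open>(i, idx j)\<close>. As
    \<open>L\<close> has at most one variable per column, \<open>j = d i\<close>, so the exponent of
    the generator at \<open>i\<close> is at least \<open>d i\<close>, more than \<open>w0\<close>
    allows.\<close>
  have w0: "w0 \<notin> U"
  proof
    assume "w0 \<in> U"
    then obtain g where g: "g \<in> ?G" "\<And>i. ?l g i \<le> w0 i" by (auto simp: U_def le_fun_def)
    obtain i j where ij: "(i, idx j) \<in> L" "1 \<le> j" "j \<le> ?l g i" using cover[OF g(1)] by auto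
    then have "i \<in> F" by (force simp: F_def)
    then have "(i, idx j) = (i, idx (d i))" using inj ij(1) dL by (metis fst_conv inj_onD)
    then have "j = d i"
      using idx ij N[OF g(1), of i] d[OF \<open>i \<in> F\<close>] by (auto dest!: inj_onD)
    then show False using g(2)[of i] ij d(1)[OF \<open>i \<in> F\<close>] \<open>i \<in> F\<close> by (simp add: w0_def)
  qed
  define T where "T w \<longleftrightarrow> w \<notin> U \<and> w0 \<le> w \<and> (\<forall>i. i \<notin> F \<longrightarrow> w i = N)" for w
  \<comment> \<open>If the exponent at some \<open>i \<in> F\<close> exceeded \<open>N\<close>, the
    private generator \<open>p i\<close> would divide the monomial: its exponent is below
    \<open>d t\<close> at every other \<open>t \<in> F\<close> and at most \<open>N\<close>
    elsewhere. So a candidate of largest total degree exists.\<close>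
  have bounded: "w i \<le> N" if "T w" for w i
  proof (rule ccontr)
    assume "\<not> w i \<le> N"
    then have "i \<in> F" using that by (metis T_def order_refl)
    have "?l (p i) t \<le> w t" for t
    proof (cases "t \<in> F \<and> t \<noteq> i")
      case True
      then have "idx (d t) \<notin> idx ` {1..?l (p i) t}" using pu[OF \<open>i \<in> F\<close> dL] by blast
      then have "?l (p i) t \<le> d t - 1" using d(1)[of t] True by fastforce
      also have "\<dots> \<le> w t" using that True le_funD[of w0 w t] by (auto simp: T_def w0_def)
      finally show ?thesis .
    next
      case False
      then show ?thesis
        using N[OF p[OF \<open>i \<in> F\<close>], of t] \<open>\<not> w i \<le> N\<close> that by (cases "t = i") (auto simp: T_def)
    qed
    then have "w \<in> U" using p[OF \<open>i \<in> F\<close>] by (auto simp: U_def le_fun_def)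
    then show False using that by (simp add: T_def)
  qed
  have "T w0" using w0 by (simp add: T_def) (simp add: w0_def)
  moreover have "sum w UNIV < Suc (card (UNIV :: 'v set) * N)" if "T w" for w
    using sum_bounded_above[of UNIV w N] bounded[OF that] by simp
  ultimately obtain w where w: "T w" and max: "\<And>v. T v \<Longrightarrow> sum v UNIV \<le> sum w UNIV"
    using ex_has_greatest_nat[of T w0 "\<lambda>w. sum w UNIV"] by blast
  \<comment> \<open>Factors outside \<open>F\<close> never bring \<open>w\<close> into
    \<open>U\<close>, since \<open>w\<close> is already \<open>N\<close> there and generators do not
    exceed \<open>N\<close>. Any factor in \<open>F\<close> does, by maximality of
    \<open>w\<close>.\<close>
  have "shift_back U w = leaf F"
  proof (intro equalityI subsetI)
    fix m assume "m \<in> shift_back U w"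
    then obtain g where g: "g \<in> ?G" "\<And>i. ?l g i \<le> m i + w i"
      by (auto simp: shift_back_def U_def le_fun_def)
    show "m \<in> leaf F"
    proof (rule ccontr)
      assume "m \<notin> leaf F"
      then have "?l g i \<le> w i" for i
        using g(2)[of i] N[OF g(1), of i] w by (cases "i \<in> F") (auto simp: leaf_def T_def)
      then have "w \<in> U" using g(1) by (auto simp: U_def le_fun_def)
      then show False using w by (simp add: T_def)
    qed
  next
    fix m assume "m \<in> leaf F"
    then obtain i where i: "i \<in> F" "0 < m i" by (auto simp: leaf_def)
    let ?v = "w(i := Suc (w i))"
    have "sum w UNIV < sum ?v UNIV" by (rule sum_strict_mono_ex1) auto
    then have "\<not> T ?v" using max by (meson not_le)
    moreover have "w0 \<le> ?v" "\<forall>t. t \<notin> F \<longrightarrow> ?v t = N"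
      using w i by (auto simp: T_def le_fun_def le_SucI)
    ultimately have "?v \<in> U" by (auto simp: T_def)
    then show "m \<in> shift_back U w"
      unfolding shift_back_def using i by (auto intro: upsetD[OF up])
  qed
  then have "colon I (mono (Abs_poly_mapping w)) = ideal_of (leaf F)"
    by (simp add: IU colon_ideal_of)
  then have "ideal_of (leaf F) \<in> Ass I" using prime_ideal_leaf unfolding Ass_def by blast
  then show ?thesis using inj by (simp add: F_def)
qed

section \<open>Depolarization of the whole tree along the first projection\<close>

theorem theorem3p3:
  fixes I :: "(('v::finite \<Rightarrow>\<^sub>0 nat) \<Rightarrow>\<^sub>0 'k::field) set"
    and idx :: "nat \<Rightarrow> 'w::finite"
    and N k :: nat
  assumes "monomial_ideal I" and "I \<noteq> UNIV"
    and "Ass I = minprimes I"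
    and "inj_on idx {1..N}"
    and "\<forall>m\<in>mingens I. \<forall>i. Poly_Mapping.lookup m i \<le> N"
    and "kclean k (polarization idx I :: (('v \<times> 'w \<Rightarrow>\<^sub>0 nat) \<Rightarrow>\<^sub>0 'k) set)"
  shows "kclean k I"
proof -
  let ?l = Poly_Mapping.lookup
  define W where "W = {a. \<exists>g\<in>mingens I. ?l (polarize idx g) \<le> a}"
  define U where "U = {m. \<exists>g\<in>mingens I. ?l g \<le> m}"
  \<comment> \<open>The absence of embedded primes enters here: the associated primes obtained from
    the covers are minimal primes of \<open>I\<close>.\<close>
  have covers: "inj_on fst L" "ideal_of (leaf (fst ` L)) \<in> minprimes I" if "L \<in> min_covers W" for L
    using min_cover_polarization[OF assms(1,4), of L] assms(3,5) that by (auto simp: W_def)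
  have "upset W" using upset_generated[of "(\<lambda>g. ?l (polarize idx g)) ` mingens I"] by (simp add: W_def)
  then have "clean_tree k (min_covers W) W"
    using assms(6) minprimes_ideal_of[of W] unfolding polarization_eq_ideal_of W_def[symmetric]
    by (intro kclean_clean_tree) auto
  then have "clean_tree k ((`) fst ` min_covers W) (push_set fst W)"
    using covers(1) by (intro clean_tree_push) auto
  \<comment> \<open>Depolarizing the generators of the polarization gives back the minimal
    generators of \<open>I\<close>.\<close>
  moreover have "push_set fst W = U"
  proof -
    have pf: "push fst (?l (polarize idx g)) = ?l g" if "g \<in> mingens I" for g
      by (rule push_fst_polarize, rule inj_on_subset[OF assms(4)]) (use that assms(5) in auto)
    then have "push fst a \<in> U" if "a \<in> W" for a
      using that push_mono[of _ a fst] by (force simp: W_def U_def)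
    moreover have from_gens: "m \<in> push_set fst W" if "g \<in> mingens I" "?l g \<le> m" for g m
      using that pf by (intro push_setI[of "?l (polarize idx g)"]) (auto simp: W_def)
    moreover have "upset U" using upset_generated[of "?l ` mingens I"] by (simp add: U_def)
    ultimately have "m \<in> U" if "a \<in> W" "push fst a \<le> m" for a m
      using that unfolding upset_def by blast
    then have "push_set fst W \<subseteq> U" unfolding push_set_def by blast
    moreover have "U \<subseteq> push_set fst W" using from_gens by (auto simp: U_def)
    ultimately show ?thesis by blast
  qed
  ultimately have "kclean k (ideal_of U :: (('v \<Rightarrow>\<^sub>0 nat) \<Rightarrow>\<^sub>0 'k) set)"
  proof (intro clean_tree_kclean)
    \<comment> \<open>Distinct leaves of the depolarized tree are incomparable because they are
      minimal primes of the same ideal.\<close>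
    fix F F' assume F: "F \<in> (`) fst ` min_covers W" "F' \<in> (`) fst ` min_covers W" "F \<subseteq> F'"
    then have "ideal_of (leaf F) \<in> minprimes I" "ideal_of (leaf F') \<in> minprimes I"
      using covers(2) by auto
    moreover have "(ideal_of (leaf F) :: (('v \<Rightarrow>\<^sub>0 nat) \<Rightarrow>\<^sub>0 'k) set) \<subseteq> ideal_of (leaf F')"
      using F(3) by (simp add: ideal_of_subset_iff leaf_subset_iff)
    ultimately have "(ideal_of (leaf F) :: (('v \<Rightarrow>\<^sub>0 nat) \<Rightarrow>\<^sub>0 'k) set) = ideal_of (leaf F')"
      unfolding minprimes_def by blast
    then show "F = F'" by (metis ideal_of_inject leaf_subset_iff order_antisym order_refl)
  qed auto
  then show ?thesis using ideal_of_mingens[OF assms(1)] by (simp add: U_def)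
qed

end
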